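(* Let $(L_0,\tilde z_0)$, $L_0>0$, satisfy $f(L_0,\tilde z_0)=0$ and let $\tilde v_*(y):=\tilde v(y;L_0,\tilde z_0)$ denote the corresponding steady state, i.e. the solution of $-\tilde v_{yy}+L_0^2(\tilde v^3-\tilde v+\zeta(L_0y))=0$ on $(0,1)$ with $\tilde v(0)=c_0$, $\tilde v_y(0)=\tilde z_0$, $\tilde v_y(1)=0$. Let $\mathcal M_{L_0}h:=-h_{yy}+L_0^2(3\tilde v_*^2(y)-1)h$ on $L^2(0,1)$ with domain $D(\mathcal M_{L_0})=\{h\in H^2(0,1): h(0)=0=h_y(1)\}$, so that $\ker\mathcal M_{L_0}$ is the set of solutions of $$\mathcal M_{L_0}h=0\ \text{ on }(0,1),\qquad h(0)=0,\quad h_y(1)=0.$$ Then $\partial_{\tilde z}f(L_0,\tilde z_0)=0$ if and only if $\ker\mathcal M_{L_0}\neq\{0\}$.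
   Context: $c_0\in\mathbb R$ is a fixed constant and $\zeta$ is a fixed (independent of $L$) real-analytic function with values in $(-1,0)$ on an open interval containing $[0,\infty)$. For $L>0$ and $\tilde z\in\mathbb R$, $\tilde v(\cdot;L,\tilde z)$ denotes the solution on $[0,1]$ of the initial value problem $$-\tilde v_{yy}(y)+L^2\big(\tilde v(y)^3-\tilde v(y)+\zeta(Ly)\big)=0\ \ (y\in(0,1)),\qquad \tilde v(0)=c_0,\quad \tilde v_y(0)=\tilde z,$$ and $f(L,\tilde z):=\tilde v_y(1;L,\tilde z)$ (for those $(L,\tilde z)$ for which the solution exists on all of $[0,1]$). *)

theory Defs
  imports "HOL-Analysis.Analysis"
begin

definition real_analytic_on :: "(real \<Rightarrow> real) \<Rightarrow> real set \<Rightarrow> bool"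
    (infix \<open>real'_analytic'_on\<close> 50) where
  "g real_analytic_on S \<longleftrightarrow> (\<forall>x\<in>S. \<exists>F. (\<lambda>h. g (x + h)) has_fps_expansion F)"


section \<open>The initial value problem\<close>

text \<open>
  A solution on [0,1] is C^1 up to the boundary (one-sided derivatives at 0 and 1), with first
  derivative \<open>w\<close>, and twice differentiable in the open interval, where the equation holds.
  Values of \<open>v\<close> outside [0,1] are irrelevant.
\<close>

definition ivp_solution ::
    "real \<Rightarrow> (real \<Rightarrow> real) \<Rightarrow> real \<Rightarrow> real \<Rightarrow> (real \<Rightarrow> real) \<Rightarrow> bool" where
  "ivp_solution c\<^sub>0 \<zeta> L z v \<longleftrightarrow>
     (\<exists>w d. (\<forall>y\<in>{0..1}. (v has_real_derivative w y) (at y within {0..1})) \<and>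
            continuous_on {0..1} w \<and>
            (\<forall>y\<in>{0<..<1}. (w has_real_derivative d y) (at y) \<and>
                          - d y + L\<^sup>2 * ((v y) ^ 3 - v y + \<zeta> (L * y)) = 0) \<and>
            v 0 = c\<^sub>0 \<and> w 0 = z)"

definition ivp_solvable :: "real \<Rightarrow> (real \<Rightarrow> real) \<Rightarrow> real \<Rightarrow> real \<Rightarrow> bool" where
  "ivp_solvable c\<^sub>0 \<zeta> L z \<longleftrightarrow> (\<exists>v. ivp_solution c\<^sub>0 \<zeta> L z v)"

text \<open>
  For continuous \<open>\<zeta>\<close> the right-hand side is locally Lipschitz in \<open>v\<close>, so two solutions of the
  same problem agree on [0,1] and the choice below is immaterial there.
\<close>

definition ivp_sol :: "real \<Rightarrow> (real \<Rightarrow> real) \<Rightarrow> real \<Rightarrow> real \<Rightarrow> real \<Rightarrow> real" where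
  "ivp_sol c\<^sub>0 \<zeta> L z = (SOME v. ivp_solution c\<^sub>0 \<zeta> L z v)"

text \<open>Meaningful only if \<open>ivp_solvable c\<^sub>0 \<zeta> L z\<close>.\<close>

definition shoot :: "real \<Rightarrow> (real \<Rightarrow> real) \<Rightarrow> real \<Rightarrow> real \<Rightarrow> real" where
  "shoot c\<^sub>0 \<zeta> L z = vector_derivative (ivp_sol c\<^sub>0 \<zeta> L z) (at 1 within {0..1})"


section \<open>L^2 and Sobolev spaces on (0,1)\<close>

abbreviation leb01 :: "real measure" where
  "leb01 \<equiv> lebesgue_on {0<..<1}"

text \<open>
  Elements of L^2(0,1) are handled through representatives; \<open>ae_class\<close> passes to the class
  modulo equality almost everywhere.
\<close>

definition L2_01 :: "(real \<Rightarrow> real) set" where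
  "L2_01 = {u \<in> borel_measurable leb01. integrable leb01 (\<lambda>x. (u x)\<^sup>2)}"

definition ae_class :: "(real \<Rightarrow> real) \<Rightarrow> (real \<Rightarrow> real) set" where
  "ae_class u = {g \<in> borel_measurable leb01. AE x in leb01. g x = u x}"

text \<open>
  Weak derivatives are tested against C^1 functions with compact support in (0,1).
\<close>

definition test_fun :: "(real \<Rightarrow> real) \<Rightarrow> bool" where
  "test_fun \<phi> \<longleftrightarrow> \<phi> C1_differentiable_on UNIV \<and> closure {x. \<phi> x \<noteq> 0} \<subseteq> {0<..<1}"

definition has_weak_deriv :: "(real \<Rightarrow> real) \<Rightarrow> (real \<Rightarrow> real) \<Rightarrow> bool" where
  "has_weak_deriv u g \<longleftrightarrow>
     (\<forall>\<phi>. test_fun \<phi> \<longrightarrow>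
        (\<integral>x. u x * deriv \<phi> x \<partial>leb01) = - (\<integral>x. g x * \<phi> x \<partial>leb01))"

definition H1_01 :: "(real \<Rightarrow> real) set" where
  "H1_01 = {u \<in> L2_01. \<exists>g\<in>L2_01. has_weak_deriv u g}"

text \<open>Determined only up to a null set.\<close>

definition weak_deriv :: "(real \<Rightarrow> real) \<Rightarrow> real \<Rightarrow> real" where
  "weak_deriv u = (SOME g. g \<in> L2_01 \<and> has_weak_deriv u g)"

definition H2_01 :: "(real \<Rightarrow> real) set" where
  "H2_01 = {u \<in> H1_01. weak_deriv u \<in> H1_01}"


section \<open>The linearised operator\<close>

text \<open>
  The boundary values h(0) and h_y(1) of a class in H^2(0,1) are those of its representative \<open>k\<close>
  that is C^1 on [0,1].
\<close>

definition dom_M :: "(real \<Rightarrow> real) set" where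
  "dom_M = {h \<in> H2_01. \<exists>k k'.
     (AE x in leb01. h x = k x) \<and>
     (\<forall>y\<in>{0..1}. (k has_real_derivative k' y) (at y within {0..1})) \<and>
     continuous_on {0..1} k' \<and> k 0 = 0 \<and> k' 1 = 0}"

definition op_M :: "real \<Rightarrow> (real \<Rightarrow> real) \<Rightarrow> (real \<Rightarrow> real) \<Rightarrow> real \<Rightarrow> real" where
  "op_M L v h = (\<lambda>y. - weak_deriv (weak_deriv h) y + L\<^sup>2 * (3 * (v y)\<^sup>2 - 1) * h y)"

definition ker_M :: "real \<Rightarrow> (real \<Rightarrow> real) \<Rightarrow> (real \<Rightarrow> real) set set" where
  "ker_M L v = ae_class ` {h \<in> dom_M. AE y in leb01. op_M L v h y = 0}"

end

theory Submission
  imports Defs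
begin

text \<open>
  Let h solve the linearised problem \<open>h'' = L\<^sup>2 (3 v\<^sup>2 - 1) h\<close>, \<open>h 0 = 0\<close>, \<open>h' 0 = 1\<close>. A Gronwall
  estimate for the second-order Taylor remainder of the solution in the initial slope shows that the
  derivative of the shooting map is \<open>h' 1\<close>. A kernel element is, by the lemmas of the calculus
  of variations and du Bois-Reymond, represented by a classical solution vanishing at 0, hence by a
  multiple of h; so the kernel is nontrivial iff \<open>h' 1 = 0\<close>.
\<close>


section \<open>Ordinary differential equations on the unit interval\<close>

text \<open>Only the solution at \<open>z\<^sub>0\<close> is given, and a cubic right-hand side is
  only locally Lipschitz: solutions with nearby slopes might blow up before time 1. Their existence
  on all of [0,1] is therefore part of what differentiability of the shooting map requires, and it
  has to come from a globally Lipschitz auxiliary equation. Estimating the remainder to second order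
  then yields the derivative directly, with no separate theorem on smooth dependence on initial
  data. On the operator side, kernel elements are classes modulo null sets and
  \<open>weak_deriv\<close> is an arbitrary choice within such a class. Every argument must first
  pass to continuous representatives, the only place where the boundary conditions make sense and
  where uniqueness for the differential equation can be applied. Both sides meet in the single
  number \<open>k 1\<close>, the slope of the linearised solution at 1.\<close>

lemma picard_exists:
  fixes G :: "real \<Rightarrow> 'a::euclidean_space \<Rightarrow> 'a"
  assumes cont: "continuous_on ({0..1} \<times> UNIV) (\<lambda>p. G (fst p) (snd p))"
    and lip: "\<And>t x y. t \<in> {0..1} \<Longrightarrow> norm (G t x - G t y) \<le> K * norm (x - y)"
  obtains X where "X 0 = x0"
    "\<And>t. t \<in> {0..1} \<Longrightarrow> (X has_vector_derivative G t (X t)) (at t within {0..1})"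
proof -
  \<comment> \<open>The fixed point \<open>Y\<close> represents \<open>exp (- l * t) *\<^sub>R X t\<close>; this weight makes the integral
    operator a contraction on all of [0,1] at once.\<close>
  define l where "l = 2 * (\<bar>K\<bar> + 1)"
  \<comment> \<open>The contraction factor will be \<open>K / l\<close>; the factor 2 brings it down
    to 1/2, and adding 1 keeps \<open>l\<close> positive even for \<open>K = 0\<close>.\<close>
  have l: "l > 0" "K \<le> l / 2" by (auto simp: l_def)
  \<comment> \<open>Clamping time to [0,1] lets the iteration run in the Banach space of bounded
    continuous functions on the whole line.\<close>
  define c :: "real \<Rightarrow> real" where "c t = max 0 (min 1 t)" for t
  have c: "c t \<in> {0..1}" for t by (auto simp: c_def)
  have c_id: "c t = t" if "t \<in> {0..1}" for t using that by (auto simp: c_def)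
  have c_cont: "continuous_on S c" for S unfolding c_def by (intro continuous_intros)
  define H where "H Y s = G s (exp (l * s) *\<^sub>R apply_bcontfun Y s)" for Y s
  have H_cont: "continuous_on {0..1} (H Y)" for Y
    unfolding H_def
    by (rule continuous_on_compose2[OF cont, where f="\<lambda>s. (s, exp (l * s) *\<^sub>R apply_bcontfun Y s)", simplified])
      (auto intro!: continuous_intros)
  have H_int: "H Y integrable_on {0..c t}" for Y t
    using c[of t] by (intro integrable_continuous_real continuous_on_subset[OF H_cont]) auto
  define P where "P Y t = exp (- l * c t) *\<^sub>R (x0 + integral {0..c t} (H Y))" for Y t
  have P_bc: "P Y \<in> bcontfun" for Y
  proof -
    define Q where "Q s = exp (- l * s) *\<^sub>R (x0 + integral {0..s} (H Y))" for s
    have Q: "continuous_on {0..1} Q"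
      unfolding Q_def
      by (intro continuous_intros indefinite_integral_continuous_1 integrable_continuous_real H_cont)
    have "continuous_on UNIV (\<lambda>t. Q (c t))"
      by (rule continuous_on_compose2[OF Q c_cont]) (use c in auto)
    moreover have "bounded (Q ` {0..1})"
      by (intro compact_imp_bounded compact_continuous_image Q) auto
    then have "bounded (range (\<lambda>t. Q (c t)))"
      by (rule bounded_subset) (use c in auto)
    ultimately show ?thesis by (simp add: bcontfun_def P_def[abs_def] Q_def)
  qed
  define \<Phi> where "\<Phi> Y = Bcontfun (P Y)" for Y
  have \<Phi>: "apply_bcontfun (\<Phi> Y) = P Y" for Y
    unfolding \<Phi>_def by (simp add: Bcontfun_inverse P_bc)
  have contr: "dist (\<Phi> Y) (\<Phi> Z) \<le> 1/2 * dist Y Z" for Y Z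
  proof (rule dist_bound)
    fix t
    let ?d = "dist Y Z"
    \<comment> \<open>The division by \<open>l\<close> in the antiderivative of the weight is the
      gain that produces the contraction.\<close>
    have e: "((\<lambda>s. K * ?d * exp (l * s)) has_integral
        (K * ?d * exp (l * c t) / l - K * ?d * exp (l * 0) / l)) {0..c t}"
      using c[of t] l
      by (intro fundamental_theorem_of_calculus)
        (auto intro!: derivative_eq_intros simp flip: has_real_derivative_iff_has_vector_derivative)
    have b: "norm (H Y s - H Z s) \<le> K * ?d * exp (l * s)" if "s \<in> {0..c t}" for s
    proof -
      have s: "s \<in> {0..1}" using that c[of t] by auto
      \<comment> \<open>Comparing \<open>y\<close> with 0 in the Lipschitz bound forces
        \<open>K * norm y\<close> to be nonnegative; a basis vector has norm 1 and so gives the sign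
        of \<open>K\<close>.\<close>
      have K0: "K * norm (y::'a) \<ge> 0" for y
        using lip[of 0 y 0] norm_ge_zero[of "G 0 y - G 0 0"] by (simp del: norm_ge_zero)
      obtain b :: 'a where "b \<in> Basis" by (meson nonempty_Basis ex_in_conv)
      with K0[of b] have K: "K \<ge> 0" by simp
      have "norm (H Y s - H Z s)
          \<le> K * norm (exp (l * s) *\<^sub>R apply_bcontfun Y s - exp (l * s) *\<^sub>R apply_bcontfun Z s)"
        unfolding H_def by (rule lip[OF s])
      also have "\<dots> = K * exp (l * s) * dist (apply_bcontfun Y s) (apply_bcontfun Z s)"
        by (simp add: dist_norm flip: scaleR_diff_right)
      also have "\<dots> \<le> K * exp (l * s) * ?d"
        using K by (intro mult_left_mono dist_bounded) auto
      finally show ?thesis by (simp add: mult_ac)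
    qed
    have i: "norm (integral {0..c t} (\<lambda>s. H Y s - H Z s)) \<le> integral {0..c t} (\<lambda>s. K * ?d * exp (l * s))"
      using e b by (intro integral_norm_bound_integral integrable_diff H_int) (auto simp: has_integral_integrable)
    have "dist (P Y t) (P Z t) = exp (- l * c t) * norm (integral {0..c t} (\<lambda>s. H Y s - H Z s))"
      unfolding P_def dist_norm integral_diff[OF H_int H_int]
      by (simp flip: scaleR_diff_right)
    also have "\<dots> \<le> exp (- l * c t) * (K * ?d * exp (l * c t) / l - K * ?d * exp (l * 0) / l)"
      using i integral_unique[OF e] by (intro mult_left_mono) auto
    also have "\<dots> = K * ?d * (1 - exp (- l * c t)) / l"
      using l by (simp add: field_simps exp_minus)
    also have "\<dots> \<le> l / 2 * ?d * 1 / l"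
    proof (intro divide_right_mono mult_mono)
      have "l * c t \<ge> 0" using l c[of t] by auto
      then show "0 \<le> 1 - exp (- l * c t)" by simp
    qed (use l in auto)
    also have "\<dots> = 1/2 * ?d" using l by simp
    finally show "dist (apply_bcontfun (\<Phi> Y) t) (apply_bcontfun (\<Phi> Z) t) \<le> 1/2 * ?d"
      by (simp add: \<Phi>)
  qed
  obtain Y where Y: "\<Phi> Y = Y"
    using banach_fix_type[of "1/2" \<Phi>] contr by auto
  define X where "X t = exp (l * t) *\<^sub>R apply_bcontfun Y t" for t
  have X: "X t = x0 + integral {0..t} (\<lambda>s. G s (X s))" if "t \<in> {0..1}" for t
  proof -
    have "apply_bcontfun Y t = P Y t" using \<Phi>[of Y] Y by simp
    then show ?thesis
      by (simp add: X_def P_def c_id[OF that] H_def[abs_def] exp_minus)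
  qed
  have "(X has_vector_derivative G t (X t)) (at t within {0..1})" if t: "t \<in> {0..1}" for t
  proof -
    have "((\<lambda>t. x0 + integral {0..t} (\<lambda>s. G s (X s))) has_vector_derivative G t (X t)) (at t within {0..1})"
      using integral_has_vector_derivative[OF H_cont[of Y] t]
      by (auto intro!: derivative_eq_intros simp: H_def[abs_def] X_def)
    then show ?thesis
      by (rule has_vector_derivative_transform[OF t X, rotated])
  qed
  moreover have "X 0 = x0" using X[of 0] by simp
  ultimately show ?thesis using that by blast
qed

text \<open>Same regularity as in \<open>ivp_solution\<close>, with the second derivative eliminated
  and the initial data left out, so that the cubic equation, its cutoff version and its
  linearisation share one predicate.\<close>

definition ode2_solution :: "(real \<Rightarrow> real \<Rightarrow> real) \<Rightarrow> (real \<Rightarrow> real) \<Rightarrow> (real \<Rightarrow> real) \<Rightarrow> bool" where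
  "ode2_solution g u w \<longleftrightarrow>
     (\<forall>t\<in>{0..1}. (u has_real_derivative w t) (at t within {0..1})) \<and>
     continuous_on {0..1} w \<and>
     (\<forall>t\<in>{0<..<1}. (w has_real_derivative g t (u t)) (at t))"

lemma ode2_solutionD:
  assumes "ode2_solution g u w"
  shows "\<And>t. t \<in> {0..1} \<Longrightarrow> (u has_real_derivative w t) (at t within {0..1})"
    "\<And>t. t \<in> {0<..<1} \<Longrightarrow> (u has_real_derivative w t) (at t)"
    "\<And>t. t \<in> {0<..<1} \<Longrightarrow> (w has_real_derivative g t (u t)) (at t)"
    "continuous_on {0..1} u" "continuous_on {0..1} w"
proof -
  show d: "(u has_real_derivative w t) (at t within {0..1})" if "t \<in> {0..1}" for t
    using assms that by (auto simp: ode2_solution_def)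
  show "(u has_real_derivative w t) (at t)" if t: "t \<in> {0<..<1}" for t
    using d[of t] t by (simp add: at_within_Icc_at)
  show "continuous_on {0..1} u"
    using d by (meson DERIV_isCont continuous_on_eq_continuous_within has_field_derivative_imp_has_derivative has_derivative_continuous)
qed (use assms in \<open>auto simp: ode2_solution_def\<close>)

lemma ode2_exists:
  assumes cont: "continuous_on ({0..1} \<times> UNIV) (\<lambda>p. g (fst p) (snd p))"
    and lip: "\<And>t x y. t \<in> {0..1} \<Longrightarrow> \<bar>g t x - g t y\<bar> \<le> K * \<bar>x - y\<bar>"
  obtains u w where "ode2_solution g u w" "u 0 = a" "w 0 = b"
proof -
  define G where "G t p = (snd p, g t (fst p))" for t and p :: "real \<times> real"
  \<comment> \<open>The first component of \<open>G\<close> contributes the 1, the second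
    contributes \<open>\<bar>K\<bar>\<close>.\<close>
  have lipG: "norm (G t p - G t q) \<le> (1 + \<bar>K\<bar>) * norm (p - q)" if t: "t \<in> {0..1}" for t p q
  proof -
    have "norm (G t p - G t q) \<le> \<bar>snd p - snd q\<bar> + \<bar>g t (fst p) - g t (fst q)\<bar>"
      unfolding G_def using norm_Pair_le[of "snd p - snd q" "g t (fst p) - g t (fst q)"] by simp
    moreover have "\<bar>g t (fst p) - g t (fst q)\<bar> \<le> \<bar>K\<bar> * norm (p - q)"
    proof -
      have "\<bar>g t (fst p) - g t (fst q)\<bar> \<le> \<bar>K\<bar> * \<bar>fst p - fst q\<bar>"
        by (rule order_trans[OF lip[OF t]]) (simp add: mult_right_mono)
      also have "\<dots> \<le> \<bar>K\<bar> * norm (p - q)"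
        using norm_fst_le[of "fst p - fst q" "snd p - snd q"]
        by (intro mult_left_mono) (simp_all add: minus_prod_def)
      finally show ?thesis .
    qed
    moreover have "\<bar>snd p - snd q\<bar> \<le> norm (p - q)"
      using norm_snd_le[of "snd p - snd q" "fst p - fst q"] by (simp add: minus_prod_def)
    ultimately show ?thesis by (simp add: distrib_right)
  qed
  have contG: "continuous_on ({0..1} \<times> UNIV) (\<lambda>p. G (fst p) (snd p))"
    unfolding G_def
    by (intro continuous_intros continuous_on_compose2[OF cont, where f="\<lambda>p. (fst p, fst (snd p))", simplified])
      auto
  obtain X where X: "X 0 = (a, b)"
    "\<And>t. t \<in> {0..1} \<Longrightarrow> (X has_vector_derivative G t (X t)) (at t within {0..1})"
    using picard_exists[OF contG lipG] by blast
  have d: "((\<lambda>t. fst (X t)) has_real_derivative snd (X t)) (at t within {0..1})"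
      "((\<lambda>t. snd (X t)) has_real_derivative g t (fst (X t))) (at t within {0..1})"
    if "t \<in> {0..1}" for t
    using has_derivative_fst[OF X(2)[OF that, unfolded has_vector_derivative_def]]
      has_derivative_snd[OF X(2)[OF that, unfolded has_vector_derivative_def]]
    by (simp_all add: G_def has_field_derivative_def mult_commute_abs)
  have "((\<lambda>t. snd (X t)) has_real_derivative g t (fst (X t))) (at t)" if t: "t \<in> {0<..<1}" for t
    using d(2)[of t] t by (simp add: at_within_Icc_at)
  moreover have "continuous_on {0..1} (\<lambda>t. snd (X t))"
    using d(2) by (meson continuous_on_eq_continuous_within has_field_derivative_imp_has_derivative has_derivative_continuous)
  ultimately have "ode2_solution g (\<lambda>t. fst (X t)) (\<lambda>t. snd (X t))"
    using d(1) by (simp add: ode2_solution_def)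
  then show ?thesis using that X(1) by simp
qed

text \<open>Adding the constant \<open>\<epsilon>\<^sup>2\<close> to the energy
  \<open>e\<^sup>2 + d\<^sup>2\<close> absorbs the inhomogeneity and leaves
  \<open>E' \<le> (K + 2) * E\<close>. With \<open>\<epsilon> = 0\<close> this gives uniqueness and
  Lipschitz dependence on the slope; with \<open>\<epsilon>\<close> quadratic in the slope increment
  it controls the Taylor remainder.\<close>

lemma gronwall_second_order:
  fixes e d r :: "real \<Rightarrow> real"
  assumes e_cont: "continuous_on {0..1} e" and d_cont: "continuous_on {0..1} d"
    and e': "\<And>t. t \<in> {0<..<1} \<Longrightarrow> (e has_real_derivative d t) (at t)"
    and d': "\<And>t. t \<in> {0<..<1} \<Longrightarrow> (d has_real_derivative r t) (at t)"
    and r: "\<And>t. t \<in> {0<..<1} \<Longrightarrow> \<bar>r t\<bar> \<le> K * \<bar>e t\<bar> + \<epsilon>"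
    and K: "K \<ge> 0" and t: "t \<in> {0..1}"
  shows "(e t)\<^sup>2 + (d t)\<^sup>2 \<le> exp (K + 2) * ((e 0)\<^sup>2 + (d 0)\<^sup>2 + \<epsilon>\<^sup>2)"
proof -
  define E where "E s = (e s)\<^sup>2 + (d s)\<^sup>2 + \<epsilon>\<^sup>2" for s
  define \<phi> where "\<phi> s = exp (- (K + 2) * s) * E s" for s
  have E_cont: "continuous_on {0..1} \<phi>"
    unfolding \<phi>_def E_def by (intro continuous_intros e_cont d_cont)
  have "\<phi> t \<le> \<phi> 0"
  proof (cases "t = 0")
    case False
    have cont': "continuous_on {0..t} \<phi>" using E_cont by (rule continuous_on_subset) (use t in auto)
    have "\<exists>y. (\<phi> has_real_derivative y) (at s) \<and> y \<le> 0" if "0 < s" "s < t" for s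
    proof -
      have s: "s \<in> {0<..<1}" using that t by auto
      let ?D = "exp (- (K + 2) * s) * (2 * e s * d s + 2 * d s * r s - (K + 2) * E s)"
      have "(\<phi> has_real_derivative ?D) (at s)"
        unfolding \<phi>_def E_def
        by (rule derivative_eq_intros e'[OF s] d'[OF s] refl | simp)+ (simp add: algebra_simps)
      \<comment> \<open>Three uses of \<open>2 * a * b \<le> a\<^sup>2 + b\<^sup>2\<close>: the term
        weighted by \<open>K\<close> costs \<open>K * E s\<close>, the other two together at most
        \<open>2 * E s\<close>.\<close>
      moreover have "2 * e s * d s + 2 * d s * r s \<le> (K + 2) * E s"
      proof -
        have "2 * d s * r s \<le> 2 * \<bar>d s\<bar> * (K * \<bar>e s\<bar> + \<epsilon>)"
        proof -
          have "2 * d s * r s \<le> 2 * \<bar>d s\<bar> * \<bar>r s\<bar>"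
            using abs_ge_self[of "2 * d s * r s"] by (simp add: abs_mult)
          also have "\<dots> \<le> 2 * \<bar>d s\<bar> * (K * \<bar>e s\<bar> + \<epsilon>)"
            using r[OF s] by (intro mult_left_mono) auto
          finally show ?thesis .
        qed
        also have "\<dots> = K * (2 * \<bar>d s\<bar> * \<bar>e s\<bar>) + 2 * \<bar>d s\<bar> * \<epsilon>" by (simp add: algebra_simps)
        also have "\<dots> \<le> K * E s + ((d s)\<^sup>2 + \<epsilon>\<^sup>2)"
        proof (intro add_mono mult_left_mono K)
          show "2 * \<bar>d s\<bar> * \<bar>e s\<bar> \<le> E s"
            using sum_squares_bound[of "\<bar>d s\<bar>" "\<bar>e s\<bar>"] zero_le_power2[of \<epsilon>]
            unfolding E_def power2_abs by linarith
          show "2 * \<bar>d s\<bar> * \<epsilon> \<le> (d s)\<^sup>2 + \<epsilon>\<^sup>2"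
            using sum_squares_bound[of "\<bar>d s\<bar>" "\<epsilon>"] by simp
        qed
        finally have 1: "2 * d s * r s \<le> K * E s + ((d s)\<^sup>2 + \<epsilon>\<^sup>2)" .
        have 2: "2 * e s * d s \<le> (e s)\<^sup>2 + (d s)\<^sup>2" by (rule sum_squares_bound)
        have 3: "(e s)\<^sup>2 \<ge> 0" "\<epsilon>\<^sup>2 \<ge> 0" by auto
        have 4: "(K + 2) * E s = K * E s + 2 * (e s)\<^sup>2 + 2 * (d s)\<^sup>2 + 2 * \<epsilon>\<^sup>2"
          by (simp add: E_def algebra_simps)
        show ?thesis unfolding 4 using 1 2 3 by linarith
      qed
      then have "?D \<le> 0" by (simp add: mult_nonneg_nonpos)
      ultimately show ?thesis by blast
    qed
    then show ?thesis
      using DERIV_nonpos_imp_decreasing_open[of 0 t \<phi>] cont' t False by auto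
  qed simp
  then have "exp (- (K + 2) * t) * E t \<le> E 0" by (simp add: \<phi>_def)
  then have "exp ((K + 2) * t) * (exp (- (K + 2) * t) * E t) \<le> exp ((K + 2) * t) * E 0"
    by (intro mult_left_mono) auto
  then have "E t \<le> exp ((K + 2) * t) * E 0"
    by (simp add: algebra_simps flip: mult.assoc exp_add)
  also have "\<dots> \<le> exp (K + 2) * E 0"
    using K t by (intro mult_right_mono) (auto simp: E_def intro: mult_left_le)
  finally show ?thesis using zero_le_power2[of \<epsilon>] unfolding E_def by linarith
qed

text \<open>The Lipschitz bound is asked only on [-R,R], where both solutions stay, because the
  cubic has no global one. The difference of the solutions obeys the Gronwall estimate with zero
  initial data and no inhomogeneity.\<close>

lemma ode2_unique:
  assumes u: "ode2_solution g u w" and u': "ode2_solution g u' w'"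
    and lip: "\<And>t x y. t \<in> {0<..<1} \<Longrightarrow> \<bar>x\<bar> \<le> R \<Longrightarrow> \<bar>y\<bar> \<le> R \<Longrightarrow> \<bar>g t x - g t y\<bar> \<le> K * \<bar>x - y\<bar>"
    and K: "K \<ge> 0"
    and R: "\<And>t. t \<in> {0..1} \<Longrightarrow> \<bar>u t\<bar> \<le> R" "\<And>t. t \<in> {0..1} \<Longrightarrow> \<bar>u' t\<bar> \<le> R"
    and init: "u 0 = u' 0" "w 0 = w' 0" and t: "t \<in> {0..1}"
  shows "u t = u' t" "w t = w' t"
proof -
  note D = ode2_solutionD[OF u] ode2_solutionD[OF u']
  have "(u t - u' t)\<^sup>2 + (w t - w' t)\<^sup>2 \<le> exp (K + 2) * ((u 0 - u' 0)\<^sup>2 + (w 0 - w' 0)\<^sup>2 + 0\<^sup>2)"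
    by (rule gronwall_second_order[where r = "\<lambda>t. g t (u t) - g t (u' t)"])
      (use D K t R lip in \<open>auto intro!: continuous_intros derivative_eq_intros\<close>)
  then have "(u t - u' t)\<^sup>2 + (w t - w' t)\<^sup>2 = 0"
    using init by (intro antisym) auto
  then show "u t = u' t" "w t = w' t" by (simp_all add: sum_power2_eq_zero_iff)
qed


section \<open>Differentiability of the shooting map\<close>

lemma ode2_solution_cong:
  assumes "ode2_solution g u w" "\<And>t. t \<in> {0<..<1} \<Longrightarrow> g t (u t) = g' t (u t)"
  shows "ode2_solution g' u w"
  using assms by (simp add: ode2_solution_def)

section \<open>The cubic initial value problem\<close>

lemma cubic_lipschitz:
  fixes x y R :: real
  assumes "\<bar>x\<bar> \<le> R" "\<bar>y\<bar> \<le> R"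
  shows "\<bar>(x ^ 3 - x + s) - (y ^ 3 - y + s)\<bar> \<le> (3 * R\<^sup>2 + 1) * \<bar>x - y\<bar>"
proof -
  have "(x ^ 3 - x + s) - (y ^ 3 - y + s) = (x * x + x * y + y * y - 1) * (x - y)"
    by (simp add: power3_eq_cube algebra_simps)
  moreover have "\<bar>x * x + x * y + y * y - 1\<bar> \<le> 3 * R\<^sup>2 + 1"
  proof -
    have "\<bar>a * b\<bar> \<le> R\<^sup>2" if "\<bar>a\<bar> \<le> R" "\<bar>b\<bar> \<le> R" for a b
      using mult_mono[OF that] that by (simp add: abs_mult power2_eq_square)
    from this[of x x] this[of x y] this[of y y] show ?thesis using assms by linarith
  qed
  ultimately show ?thesis by (simp add: abs_mult mult_right_mono)
qed

definition cubic_rhs :: "(real \<Rightarrow> real) \<Rightarrow> real \<Rightarrow> real \<Rightarrow> real \<Rightarrow> real" where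
  "cubic_rhs \<zeta> L t x = L\<^sup>2 * (x ^ 3 - x + \<zeta> (L * t))"

lemma cubic_rhs_lipschitz:
  assumes "\<bar>x\<bar> \<le> R" "\<bar>y\<bar> \<le> R"
  shows "\<bar>cubic_rhs \<zeta> L t x - cubic_rhs \<zeta> L t y\<bar> \<le> L\<^sup>2 * (3 * R\<^sup>2 + 1) * \<bar>x - y\<bar>"
  using mult_left_mono[OF cubic_lipschitz[OF assms, of "\<zeta> (L * t)"], of "L\<^sup>2"]
  by (simp add: cubic_rhs_def abs_mult flip: right_diff_distrib mult.assoc)

lemma ivp_solution_iff:
  "ivp_solution c\<^sub>0 \<zeta> L z v \<longleftrightarrow> (\<exists>w. ode2_solution (cubic_rhs \<zeta> L) v w \<and> v 0 = c\<^sub>0 \<and> w 0 = z)"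
proof
  assume "ivp_solution c\<^sub>0 \<zeta> L z v"
  then obtain w d where *: "\<forall>y\<in>{0..1}. (v has_real_derivative w y) (at y within {0..1})"
    "continuous_on {0..1} w" "v 0 = c\<^sub>0" "w 0 = z"
    "\<forall>y\<in>{0<..<1}. (w has_real_derivative d y) (at y) \<and> - d y + L\<^sup>2 * ((v y) ^ 3 - v y + \<zeta> (L * y)) = 0"
    unfolding ivp_solution_def by blast
  have "d y = cubic_rhs \<zeta> L y (v y)" if "y \<in> {0<..<1}" for y
    using *(5) that by (force simp: cubic_rhs_def)
  then have "ode2_solution (cubic_rhs \<zeta> L) v w"
    using * by (auto simp: ode2_solution_def)
  then show "\<exists>w. ode2_solution (cubic_rhs \<zeta> L) v w \<and> v 0 = c\<^sub>0 \<and> w 0 = z" using * by blast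
next
  assume "\<exists>w. ode2_solution (cubic_rhs \<zeta> L) v w \<and> v 0 = c\<^sub>0 \<and> w 0 = z"
  then obtain w where "ode2_solution (cubic_rhs \<zeta> L) v w" "v 0 = c\<^sub>0" "w 0 = z" by blast
  then show "ivp_solution c\<^sub>0 \<zeta> L z v"
    unfolding ivp_solution_def ode2_solution_def
    by (intro exI[of _ w] exI[of _ "\<lambda>t. cubic_rhs \<zeta> L t (v t)"]) (auto simp: cubic_rhs_def)
qed

lemma continuous_on_01_bounded:
  fixes f :: "real \<Rightarrow> real"
  assumes "continuous_on {0..1} f"
  obtains M where "M \<ge> 0" "\<And>t. t \<in> {0..1} \<Longrightarrow> \<bar>f t\<bar> \<le> M"
proof -
  have "bounded (f ` {0..1})"
    using assms by (intro compact_imp_bounded compact_continuous_image) auto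
  then obtain M where M: "\<And>x. x \<in> f ` {0..1} \<Longrightarrow> norm x \<le> M" by (auto simp: bounded_iff)
  then have M': "\<bar>f t\<bar> \<le> M" if "t \<in> {0..1}" for t using that by (metis imageI real_norm_def)
  show ?thesis
  proof (rule that[OF _ M'])
    show "M \<ge> 0" using M'[of 0] by simp
  qed
qed

text \<open>\<open>shoot\<close> hides a choice of solution and a one-sided derivative at 1.
  Uniqueness for the initial value problem settles the first, uniqueness of derivatives within a
  nondegenerate interval the second.\<close>

lemma shoot_eq:
  assumes u: "ode2_solution (cubic_rhs \<zeta> L) u w" "u 0 = c\<^sub>0" "w 0 = z"
  shows "shoot c\<^sub>0 \<zeta> L z = w 1"
proof -
  define v where "v = ivp_sol c\<^sub>0 \<zeta> L z"
  have "ivp_solution c\<^sub>0 \<zeta> L z u" using u ivp_solution_iff by blast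
  then have "ivp_solution c\<^sub>0 \<zeta> L z v" unfolding v_def ivp_sol_def by (rule someI[where P = "ivp_solution c\<^sub>0 \<zeta> L z"])
  then obtain w' where v: "ode2_solution (cubic_rhs \<zeta> L) v w'" "v 0 = c\<^sub>0" "w' 0 = z"
    unfolding ivp_solution_iff by blast
  obtain M where M: "\<And>t. t \<in> {0..1} \<Longrightarrow> \<bar>u t\<bar> \<le> M"
    using continuous_on_01_bounded[OF ode2_solutionD(4)[OF u(1)]] by blast
  obtain N where N: "\<And>t. t \<in> {0..1} \<Longrightarrow> \<bar>v t\<bar> \<le> N"
    using continuous_on_01_bounded[OF ode2_solutionD(4)[OF v(1)]] by blast
  have "w' 1 = w 1"
    by (rule ode2_unique(2)[OF v(1) u(1) cubic_rhs_lipschitz[where R = "max M N"]])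
      (use u v in \<open>auto intro: max.coboundedI1[OF M] max.coboundedI2[OF N]\<close>)
  moreover have "(v has_vector_derivative w' 1) (at 1 within {0..1})"
    using ode2_solutionD(1)[OF v(1)] by (simp flip: has_real_derivative_iff_has_vector_derivative)
  then have "vector_derivative v (at 1 within {0..1}) = w' 1"
    by (intro vector_derivative_within_closed_interval) auto
  ultimately show ?thesis by (simp add: shoot_def v_def)
qed

text \<open>The derivative of \<open>cubic_rhs\<close> in its last argument at \<open>v t\<close>,
  applied to the increment \<open>x\<close>. Being linear in \<open>x\<close>, it is globally
  Lipschitz as soon as \<open>v\<close> is bounded.\<close>

definition linearised_rhs :: "real \<Rightarrow> (real \<Rightarrow> real) \<Rightarrow> real \<Rightarrow> real \<Rightarrow> real" where
  "linearised_rhs L v t x = L\<^sup>2 * (3 * (v t)\<^sup>2 - 1) * x"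

lemma linearised_rhs_lipschitz:
  assumes "\<bar>v t\<bar> \<le> M"
  shows "\<bar>linearised_rhs L v t x - linearised_rhs L v t y\<bar> \<le> L\<^sup>2 * (3 * M\<^sup>2 + 1) * \<bar>x - y\<bar>"
proof -
  have "(v t)\<^sup>2 \<le> M\<^sup>2" using assms abs_le_square_iff[of "v t" M] by auto
  then have "\<bar>3 * (v t)\<^sup>2 - 1\<bar> \<le> 3 * M\<^sup>2 + 1" using zero_le_power2[of "v t"] by linarith
  then show ?thesis
    by (auto simp: linearised_rhs_def abs_mult simp flip: right_diff_distrib intro!: mult_mono)
qed

text \<open>The multiple \<open>(z - z\<^sub>0) * h\<close> of the linearised solution approximates
  the difference of two nonlinear solutions, slopes included, up to an error of order
  \<open>(z - z\<^sub>0)\<^sup>2\<close>.\<close>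

lemma shoot_has_derivative:
  assumes \<zeta>: "continuous_on {0..} \<zeta>" and L: "L \<ge> 0"
    and v: "ode2_solution (cubic_rhs \<zeta> L) v w" "v 0 = c\<^sub>0" "w 0 = z\<^sub>0"
    and h: "ode2_solution (linearised_rhs L v) h k" "h 0 = 0" "k 0 = 1"
  shows "(shoot c\<^sub>0 \<zeta> L has_real_derivative k 1) (at z\<^sub>0)"
proof -
  obtain M where M: "M \<ge> 0" "\<And>t. t \<in> {0..1} \<Longrightarrow> \<bar>v t\<bar> \<le> M"
    using continuous_on_01_bounded[OF ode2_solutionD(4)[OF v(1)]] by blast
  \<comment> \<open>Cutting the cubic off outside [-R,R] makes it globally Lipschitz; solutions close to \<open>v\<close>
    do not see the cutoff.\<close>
  define R where "R = M + 1"
  define cut where "cut x = max (- R) (min R x)" for x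
  have cut_bd: "\<bar>cut x\<bar> \<le> R" for x using M(1) by (auto simp: cut_def R_def)
  have cut_lip: "\<bar>cut x - cut y\<bar> \<le> \<bar>x - y\<bar>" for x y by (auto simp: cut_def)
  have cut_id: "cut x = x" if "\<bar>x\<bar> \<le> R" for x using that by (auto simp: cut_def)
  define g where "g t x = cubic_rhs \<zeta> L t (cut x)" for t x
  define K where "K = L\<^sup>2 * (3 * R\<^sup>2 + 1)"
  have K: "K \<ge> 0" by (auto simp: K_def)
  have g_lip: "\<bar>g t x - g t y\<bar> \<le> K * \<bar>x - y\<bar>" for t x y
    unfolding g_def
    using order_trans[OF cubic_rhs_lipschitz[OF cut_bd cut_bd] mult_left_mono[OF cut_lip K[unfolded K_def]]]
    by (simp add: K_def)
  have g_cont: "continuous_on ({0..1} \<times> UNIV) (\<lambda>p. g (fst p) (snd p))"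
    unfolding g_def cubic_rhs_def cut_def
    by (intro continuous_intros continuous_on_compose2[OF \<zeta>]) (use L in auto)
  have "\<exists>u w. ode2_solution g u w \<and> u 0 = c\<^sub>0 \<and> w 0 = z" for z
    using ode2_exists[OF g_cont g_lip] by metis
  then obtain U W where UW: "\<And>z. ode2_solution g (U z) (W z)" "\<And>z. U z 0 = c\<^sub>0" "\<And>z. W z 0 = z"
    by metis
  have vg: "ode2_solution g v w"
  proof (rule ode2_solution_cong[OF v(1)])
    fix t :: real assume "t \<in> {0<..<1}"
    then have "cut (v t) = v t" using M(2)[of t] by (intro cut_id) (auto simp: R_def)
    then show "cubic_rhs \<zeta> L t (v t) = g t (v t)" by (simp add: g_def)
  qed
  define C where "C = exp (K + 2)"
  have C: "C > 0" by (simp add: C_def)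
  \<comment> \<open>Both solutions of the cutoff equation start at \<open>c\<^sub>0\<close>, so the
    slope difference is the only initial error.\<close>
  have close: "(U z t - v t)\<^sup>2 \<le> C * (z - z\<^sub>0)\<^sup>2" if t: "t \<in> {0..1}" for z t
  proof -
    have "(U z t - v t)\<^sup>2 + (W z t - w t)\<^sup>2 \<le> exp (K + 2) * ((U z 0 - v 0)\<^sup>2 + (W z 0 - w 0)\<^sup>2 + 0\<^sup>2)"
      by (rule gronwall_second_order[where r = "\<lambda>t. g t (U z t) - g t (v t)"])
        (use ode2_solutionD[OF UW(1)[of z]] ode2_solutionD[OF vg] K t g_lip
          in \<open>auto intro!: continuous_intros derivative_eq_intros\<close>)
    then have "(U z t - v t)\<^sup>2 + (W z t - w t)\<^sup>2 \<le> C * (z - z\<^sub>0)\<^sup>2" using UW v by (simp add: C_def)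
    then show ?thesis using zero_le_power2[of "W z t - w t"] by linarith
  qed
  \<comment> \<open>Chosen so that \<open>C * \<delta>\<^sup>2 = 1\<close>: within this radius
    \<open>U z\<close> stays at distance at most 1 from \<open>v\<close>, which is the margin in
    \<open>R = M + 1\<close>.\<close>
  define \<delta> where "\<delta> = 1 / sqrt C"
  have \<delta>: "\<delta> > 0" using C by (simp add: \<delta>_def)
  have near: "\<bar>U z t\<bar> \<le> R" if z: "\<bar>z - z\<^sub>0\<bar> < \<delta>" and t: "t \<in> {0..1}" for z t
  proof -
    have "(z - z\<^sub>0)\<^sup>2 \<le> \<delta>\<^sup>2" using z \<delta> abs_le_square_iff[of "z - z\<^sub>0" \<delta>] by auto
    then have "C * (z - z\<^sub>0)\<^sup>2 \<le> 1" using C by (simp add: \<delta>_def power_divide field_simps)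
    then have "(U z t - v t)\<^sup>2 \<le> 1\<^sup>2" using close[OF t, of z] by simp
    then have "\<bar>U z t - v t\<bar> \<le> 1" using abs_le_square_iff[of "U z t - v t" 1] by auto
    then show ?thesis using M(2)[OF t] by (simp add: R_def)
  qed
  have U_sol: "ode2_solution (cubic_rhs \<zeta> L) (U z) (W z)" if z: "\<bar>z - z\<^sub>0\<bar> < \<delta>" for z
    by (rule ode2_solution_cong[OF UW(1)]) (use near[OF z] in \<open>simp add: g_def cut_id\<close>)
  have shoot: "shoot c\<^sub>0 \<zeta> L z = W z 1" if "\<bar>z - z\<^sub>0\<bar> < \<delta>" for z
    by (rule shoot_eq[OF U_sol[OF that] UW(2,3)])
  have shoot0: "shoot c\<^sub>0 \<zeta> L z\<^sub>0 = w 1" by (rule shoot_eq[OF v])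
  \<comment> \<open>\<open>K'\<close> is the Lipschitz constant of the linearised equation along
    \<open>v\<close>. In \<open>B\<close>, the factor \<open>3 * R\<close> will bound
    \<open>\<bar>U z t + 2 * v t\<bar>\<close> and \<open>C\<close> comes from \<open>close\<close>;
    the square root in \<open>B'\<close> undoes the squares of the Gronwall estimate.\<close>
  define K' where "K' = L\<^sup>2 * (3 * M\<^sup>2 + 1)"
  define B where "B = L\<^sup>2 * (3 * R * C)"
  define B' where "B' = sqrt (exp (K' + 2)) * B"
  have K': "K' \<ge> 0" and B: "B \<ge> 0" using C M(1) by (auto simp: K'_def B_def R_def)
  have est: "\<bar>shoot c\<^sub>0 \<zeta> L z - shoot c\<^sub>0 \<zeta> L z\<^sub>0 - (z - z\<^sub>0) * k 1\<bar> \<le> B' * (z - z\<^sub>0)\<^sup>2"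
    if z: "\<bar>z - z\<^sub>0\<bar> < \<delta>" for z
  proof -
    define e where "e t = U z t - v t - (z - z\<^sub>0) * h t" for t
    define d where "d t = W z t - w t - (z - z\<^sub>0) * k t" for t
    define r where "r t = cubic_rhs \<zeta> L t (U z t) - cubic_rhs \<zeta> L t (v t) - (z - z\<^sub>0) * linearised_rhs L v t (h t)" for t
    have r: "\<bar>r t\<bar> \<le> K' * \<bar>e t\<bar> + B * (z - z\<^sub>0)\<^sup>2" if "t \<in> {0<..<1}" for t
    proof -
      have t: "t \<in> {0..1}" using that by auto
      \<comment> \<open>Exact Taylor expansion of the cubic: \<open>U\<^sup>3 - v\<^sup>3 - 3
        v\<^sup>2 (U - v) = (U + 2 v) (U - v)\<^sup>2\<close>. The linear part acts on the error
        \<open>e\<close>, so the inhomogeneity is purely quadratic.\<close>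
      have "r t = linearised_rhs L v t (e t) + L\<^sup>2 * ((U z t + 2 * v t) * (U z t - v t)\<^sup>2)"
        by (simp add: r_def e_def cubic_rhs_def linearised_rhs_def power2_eq_square power3_eq_cube algebra_simps)
      moreover have "\<bar>linearised_rhs L v t (e t)\<bar> \<le> K' * \<bar>e t\<bar>"
        using linearised_rhs_lipschitz[of v t M L "e t" 0, OF M(2)[OF t]] by (simp add: K'_def linearised_rhs_def)
      moreover have "\<bar>U z t + 2 * v t\<bar> * (U z t - v t)\<^sup>2 \<le> (3 * R) * (C * (z - z\<^sub>0)\<^sup>2)"
      proof (intro mult_mono close t)
        show "\<bar>U z t + 2 * v t\<bar> \<le> 3 * R" using near[OF z t] M(2)[OF t] by (simp add: R_def)
      qed (use M(1) in \<open>auto simp: R_def\<close>)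
      then have "\<bar>L\<^sup>2 * ((U z t + 2 * v t) * (U z t - v t)\<^sup>2)\<bar> \<le> B * (z - z\<^sub>0)\<^sup>2"
        by (simp add: B_def abs_mult mult.assoc mult_left_mono)
      ultimately show ?thesis by linarith
    qed
    have "(e 1)\<^sup>2 + (d 1)\<^sup>2 \<le> exp (K' + 2) * ((e 0)\<^sup>2 + (d 0)\<^sup>2 + (B * (z - z\<^sub>0)\<^sup>2)\<^sup>2)"
    proof (rule gronwall_second_order[OF _ _ _ _ r K'])
      note D = ode2_solutionD[OF U_sol[OF z]] ode2_solutionD[OF v(1)] ode2_solutionD[OF h(1)]
      show "continuous_on {0..1} e" "continuous_on {0..1} d"
        unfolding e_def d_def by (intro continuous_intros D)+
      show "(e has_real_derivative d t) (at t)" "(d has_real_derivative r t) (at t)" if "t \<in> {0<..<1}" for t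
        unfolding e_def d_def r_def by (rule derivative_eq_intros D that refl | simp)+
    qed auto
    moreover have "e 0 = 0" "d 0 = 0" using UW v h by (simp_all add: e_def d_def)
    ultimately have "(e 1)\<^sup>2 + (d 1)\<^sup>2 \<le> exp (K' + 2) * (B * (z - z\<^sub>0)\<^sup>2)\<^sup>2" by simp
    then have "(d 1)\<^sup>2 \<le> exp (K' + 2) * (B * (z - z\<^sub>0)\<^sup>2)\<^sup>2"
      using zero_le_power2[of "e 1"] by linarith
    also have "\<dots> = (B' * (z - z\<^sub>0)\<^sup>2)\<^sup>2" by (simp add: B'_def power_mult_distrib)
    finally have "\<bar>d 1\<bar> \<le> \<bar>B' * (z - z\<^sub>0)\<^sup>2\<bar>" by (simp only: abs_le_square_iff)
    then show ?thesis using B shoot[OF z] shoot0 by (simp add: d_def B'_def)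
  qed
  show ?thesis
    unfolding has_field_derivative_def
  proof (rule has_derivativeI_sandwich[OF \<delta>, where H = "\<lambda>z. B' * \<bar>z - z\<^sub>0\<bar>"])
    show "norm (shoot c\<^sub>0 \<zeta> L z - shoot c\<^sub>0 \<zeta> L z\<^sub>0 - k 1 * (z - z\<^sub>0)) / norm (z - z\<^sub>0) \<le> B' * \<bar>z - z\<^sub>0\<bar>"
      if "z \<noteq> z\<^sub>0" "dist z z\<^sub>0 < \<delta>" for z
      using est[of z] that by (simp add: dist_norm field_simps power2_eq_square flip: abs_mult)
    show "((\<lambda>z. B' * \<bar>z - z\<^sub>0\<bar>) \<longlongrightarrow> 0) (at z\<^sub>0)"
      by (auto intro!: tendsto_eq_intros)
  qed (auto intro: bounded_linear_mult_right)
qed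


section \<open>Weak derivatives\<close>

lemma finite_measure_leb01: "finite_measure leb01"
  by (rule finite_measure_lebesgue_on) simp

lemma borel_measurable_leb01:
  fixes f :: "real \<Rightarrow> real"
  shows "f \<in> borel_measurable borel \<Longrightarrow> f \<in> borel_measurable leb01"
  by (intro measurable_restrict_space1 measurable_completion) simp

text \<open>A bridge from the Lebesgue integral over (0,1) to the gauge integral over [0,1], where
  the fundamental theorem of calculus is applied.\<close>

lemma leb01_continuous:
  fixes f :: "real \<Rightarrow> real"
  assumes "continuous_on {0..1} f"
  shows "f \<in> borel_measurable leb01" "integrable leb01 f" "integral\<^sup>L leb01 f = integral {0..1} f"
proof -
  show m: "f \<in> borel_measurable leb01"
    by (intro continuous_imp_measurable_on_sets_lebesgue continuous_on_subset[OF assms]) auto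
  have "bounded (f ` {0..1})"
    using assms by (intro compact_imp_bounded compact_continuous_image) auto
  then obtain M where "\<And>x. x \<in> f ` {0..1} \<Longrightarrow> norm x \<le> M" by (auto simp: bounded_iff)
  then have "norm (f x) \<le> M" if "x \<in> {0<..<1}" for x using that by auto
  then have "AE x in leb01. norm (f x) \<le> M"
    by (intro AE_I2) (simp add: space_restrict_space)
  then show i: "integrable leb01 f"
    by (rule finite_measure.integrable_const_bound[OF finite_measure_leb01 _ m])
  show "integral\<^sup>L leb01 f = integral {0..1} f"
    using lebesgue_integral_eq_integral[OF i] by (simp add: integral_open_interval_real)
qed

lemma continuous_imp_L2_01: "continuous_on {0..1} f \<Longrightarrow> f \<in> L2_01"
  unfolding L2_01_def using leb01_continuous(1) leb01_continuous(2)[of "\<lambda>x. (f x)\<^sup>2"]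
  by (auto intro: continuous_intros)

lemma L2_01_measurable: "u \<in> L2_01 \<Longrightarrow> u \<in> borel_measurable leb01"
  by (simp add: L2_01_def)

lemma L2_01_integrable: "u \<in> L2_01 \<Longrightarrow> integrable leb01 u"
  by (rule finite_measure.square_integrable_imp_integrable[OF finite_measure_leb01])
    (simp_all add: L2_01_def)

lemma L2_01_cong_AE:
  assumes "u \<in> L2_01" "u' \<in> borel_measurable leb01" "AE x in leb01. u' x = u x"
  shows "u' \<in> L2_01"
proof -
  have "integrable leb01 (\<lambda>x. (u' x)\<^sup>2) \<longleftrightarrow> integrable leb01 (\<lambda>x. (u x)\<^sup>2)"
    using assms by (intro integrable_cong_AE) (auto simp: L2_01_def)
  then show ?thesis using assms by (auto simp: L2_01_def)
qed

text \<open>The squared difference is continuous and nonnegative with integral zero. The conclusion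
  includes the endpoints, which \<open>leb01\<close> does not see.\<close>

lemma AE_leb01_continuous_eq:
  fixes f g :: "real \<Rightarrow> real"
  assumes cont: "continuous_on {0..1} f" "continuous_on {0..1} g"
    and ae: "AE x in leb01. f x = g x" and x: "x \<in> {0..1}"
  shows "f x = g x"
proof -
  have c: "continuous_on {0..1} (\<lambda>x. (f x - g x)\<^sup>2)" using cont by (intro continuous_intros)
  have "integral\<^sup>L leb01 (\<lambda>x. (f x - g x)\<^sup>2) = 0"
    using ae by (intro integral_eq_zero_AE) auto
  then have "integral {0..1} (\<lambda>x. (f x - g x)\<^sup>2) = 0"
    using leb01_continuous(3)[OF c] by simp
  then show ?thesis using integral_eq_0_iff[OF c] x by auto
qed

section \<open>Test functions and the fundamental lemma\<close>

lemma test_funD: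
  assumes "test_fun \<phi>"
  shows "(\<phi> has_real_derivative deriv \<phi> x) (at x)" "continuous_on UNIV (deriv \<phi>)"
    "continuous_on UNIV \<phi>"
proof -
  obtain D where D: "\<And>x. (\<phi> has_vector_derivative D x) (at x)" "continuous_on UNIV D"
    using assms unfolding test_fun_def C1_differentiable_on_def by blast
  then have d: "(\<phi> has_real_derivative D x) (at x)" for x
    by (simp add: has_real_derivative_iff_has_vector_derivative)
  then have [simp]: "deriv \<phi> = D" by (auto intro: DERIV_imp_deriv)
  show "(\<phi> has_real_derivative deriv \<phi> x) (at x)" for x using d by simp
  show "continuous_on UNIV (deriv \<phi>)" using D by simp
  show "continuous_on UNIV \<phi>" using d DERIV_isCont continuous_at_imp_continuous_on by blast
qed

lemma test_fun_support:
  assumes "test_fun \<phi>"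
  obtains a b where "0 < a" "a < b" "b < 1" "\<And>x. x \<notin> {a..b} \<Longrightarrow> \<phi> x = 0"
proof -
  \<comment> \<open>The two extra points make the compact set nonempty, even for the zero function,
    and force \<open>a < b\<close>.\<close>
  let ?S = "insert (1/3) (insert (2/3) (closure {x. \<phi> x \<noteq> 0}))"
  have sub: "?S \<subseteq> {0<..<1}" using assms by (auto simp: test_fun_def)
  have "bounded ?S" by (rule bounded_subset[OF _ sub]) simp
  then have "compact ?S" by (simp add: compact_eq_bounded_closed)
  then obtain a b where ab: "a \<in> ?S" "\<And>x. x \<in> ?S \<Longrightarrow> a \<le> x" "b \<in> ?S" "\<And>x. x \<in> ?S \<Longrightarrow> x \<le> b"
    using compact_attains_inf[of ?S] compact_attains_sup[of ?S] by blast
  show ?thesis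
  proof (rule that)
    show "0 < a" "b < 1" using ab(1,3) sub by auto
    show "a < b" using ab(2)[of "1/3"] ab(4)[of "2/3"] by simp
    show "\<phi> x = 0" if "x \<notin> {a..b}" for x
      using that ab(2)[of x] ab(4)[of x] closure_subset[of "{x. \<phi> x \<noteq> 0}"] by auto
  qed
qed

lemma test_funI:
  assumes "\<And>x. (\<phi> has_real_derivative D x) (at x)" "continuous_on UNIV D"
    and "0 < a" "b < 1" "\<And>x. x \<notin> {a..b} \<Longrightarrow> \<phi> x = 0"
  shows "test_fun \<phi>"
proof -
  have "closure {x. \<phi> x \<noteq> 0} \<subseteq> {a..b}"
  proof (rule closure_minimal)
    show "{x. \<phi> x \<noteq> 0} \<subseteq> {a..b}" using assms(5) by blast
  qed simp
  then have "closure {x. \<phi> x \<noteq> 0} \<subseteq> {0<..<1}" using assms(3,4) by fastforce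
  then show ?thesis
    using assms(1,2) unfolding test_fun_def C1_differentiable_on_def
    by (auto simp: has_real_derivative_iff_has_vector_derivative)
qed

lemma integrable_leb01_mult_continuous:
  fixes u f :: "real \<Rightarrow> real"
  assumes u: "integrable leb01 u" and f: "continuous_on {0..1} f"
  shows "integrable leb01 (\<lambda>x. u x * f x)"
proof -
  have "bounded (f ` {0..1})"
    using f by (intro compact_imp_bounded compact_continuous_image) auto
  then obtain M where "\<And>x. x \<in> f ` {0..1} \<Longrightarrow> norm x \<le> M" by (auto simp: bounded_iff)
  then have M: "\<bar>f x\<bar> \<le> M" if "x \<in> {0<..<1}" for x using that by auto
  show ?thesis
  proof (rule Bochner_Integration.integrable_bound)
    show "integrable leb01 (\<lambda>x. M * u x)" using u by simp
    show "(\<lambda>x. u x * f x) \<in> borel_measurable leb01"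
      using u leb01_continuous(1)[OF f] by auto
    have "\<bar>u x * f x\<bar> \<le> \<bar>M * u x\<bar>" if "x \<in> {0<..<1}" for x
      using mult_left_mono[OF M[OF that], of "\<bar>u x\<bar>"] abs_ge_self[of M]
        mult_left_mono[OF abs_ge_self[of M], of "\<bar>u x\<bar>"] by (simp add: abs_mult mult.commute)
    then show "AE x in leb01. norm (u x * f x) \<le> norm (M * u x)"
      by (intro AE_I2) (simp add: space_restrict_space)
  qed
qed

text \<open>Squaring removes the kink of \<open>max 0 x\<close> at 0, where the difference quotient
  is bounded by \<open>\<bar>y\<bar>\<close>. One continuous derivative is all that
  \<open>test_fun\<close> asks for.\<close>

lemma pos_part_square_has_derivative:
  "((\<lambda>x::real. (max 0 x)\<^sup>2) has_real_derivative 2 * max 0 x) (at x)"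
proof -
  consider "x > 0" | "x < 0" | "x = 0" by linarith
  then show ?thesis
  proof cases
    case 1
    have "((\<lambda>x. x\<^sup>2) has_real_derivative 2 * max 0 x) (at x)"
      using 1 by (auto intro!: derivative_eq_intros)
    then show ?thesis
      by (rule has_field_derivative_transform_within_open[of _ _ _ "{0<..}"]) (use 1 in auto)
  next
    case 2
    have "((\<lambda>x. 0) has_real_derivative 2 * max 0 x) (at x)"
      using 2 by (auto intro!: derivative_eq_intros)
    then show ?thesis
      by (rule has_field_derivative_transform_within_open[of _ _ _ "{..<0}"]) (use 2 in auto)
  next
    case 3
    have "((\<lambda>x::real. (max 0 x)\<^sup>2) has_derivative (\<lambda>h. 0)) (at 0)"
    proof (rule has_derivativeI_sandwich[where e = 1 and H = "\<lambda>y::real. \<bar>y\<bar>"])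
      show "((\<lambda>y::real. \<bar>y\<bar>) \<longlongrightarrow> 0) (at 0)" by (auto intro!: tendsto_eq_intros)
    qed (auto simp: max_def power2_eq_square)
    then show ?thesis using 3 by (simp add: has_field_derivative_def mult_zero_left[abs_def])
  qed
qed

text \<open>
  With \<open>q = bump a b\<close>, the C^1 functions \<open>n q / (1 + n q)\<close> increase to the indicator of (a,b).
\<close>

definition bump :: "real \<Rightarrow> real \<Rightarrow> real \<Rightarrow> real" where
  "bump a b x = (max 0 (x - a))\<^sup>2 * (max 0 (b - x))\<^sup>2"

lemma bump_nonneg: "bump a b x \<ge> 0"
  by (simp add: bump_def)

lemma bump_pos_iff: "bump a b x > 0 \<longleftrightarrow> x \<in> {a<..<b}"
  by (auto simp: bump_def zero_less_mult_iff max_def)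

lemma test_fun_plateau:
  assumes "0 < a" "b < 1" "N \<ge> 0"
  shows "test_fun (\<lambda>x. N * bump a b x / (1 + N * bump a b x))"
proof -
  define B where "B x = 2 * max 0 (x - a) * (max 0 (b - x))\<^sup>2 - (max 0 (x - a))\<^sup>2 * (2 * max 0 (b - x))" for x
  have pos: "1 + N * bump a b x > 0" for x
    using assms(3) bump_nonneg[of a b x] by (simp add: add_pos_nonneg)
  have dB: "(bump a b has_real_derivative B x) (at x)" for x
  proof -
    have 1: "((\<lambda>x. (max 0 (x - a))\<^sup>2) has_real_derivative 2 * max 0 (x - a) * 1) (at x)"
      by (rule DERIV_chain2[OF pos_part_square_has_derivative]) (auto intro!: derivative_eq_intros)
    have 2: "((\<lambda>x. (max 0 (b - x))\<^sup>2) has_real_derivative 2 * max 0 (b - x) * - 1) (at x)"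
      by (rule DERIV_chain2[OF pos_part_square_has_derivative]) (auto intro!: derivative_eq_intros)
    show ?thesis
      using DERIV_mult[OF 1 2] by (simp add: bump_def[abs_def] B_def mult_ac)
  qed
  have cB: "continuous_on UNIV (bump a b)" unfolding bump_def by (intro continuous_intros)
  show ?thesis
  proof (rule test_funI[OF _ _ assms(1,2)])
    show "((\<lambda>x. N * bump a b x / (1 + N * bump a b x)) has_real_derivative
        N * B x / (1 + N * bump a b x)\<^sup>2) (at x)" for x
    proof -
      have "((\<lambda>x. 1 + N * bump a b x) has_real_derivative N * B x) (at x)"
        using DERIV_add[OF DERIV_const[of 1] DERIV_cmult[OF dB]] by simp
      from DERIV_divide[OF DERIV_cmult[OF dB] this, of N] pos[of x] show ?thesis
        by (simp add: power2_eq_square algebra_simps)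
    qed
    show "continuous_on UNIV (\<lambda>x. N * B x / (1 + N * bump a b x)\<^sup>2)"
      unfolding B_def
    proof (intro continuous_intros cB ballI)
      show "(1 + N * bump a b x)\<^sup>2 \<noteq> 0" for x using pos[of x] by simp
    qed
    show "N * bump a b x / (1 + N * bump a b x) = 0" if "x \<notin> {a..b}" for x
      using that bump_pos_iff[of a b x] bump_nonneg[of a b x] by (auto simp: not_less)
  qed
qed

lemma plateau_tendsto:
  "(\<lambda>n. real n * bump a b x / (1 + real n * bump a b x)) \<longlonglongrightarrow> indicator {a<..<b} x"
proof (cases "x \<in> {a<..<b}")
  case True
  then have p: "bump a b x > 0" by (simp add: bump_pos_iff)
  have "filterlim (\<lambda>n. bump a b x * real n) at_top sequentially"
    by (intro filterlim_tendsto_pos_mult_at_top[OF tendsto_const p] filterlim_real_sequentially)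
  then have "filterlim (\<lambda>n. 1 + real n * bump a b x) at_top sequentially"
    by (intro filterlim_tendsto_add_at_top[OF tendsto_const]) (simp add: mult.commute)
  then have "(\<lambda>n. 1 - inverse (1 + real n * bump a b x)) \<longlonglongrightarrow> 1 - 0"
    by (intro tendsto_diff tendsto_const tendsto_inverse_0_at_top)
  moreover have "1 - inverse (1 + real n * bump a b x) = real n * bump a b x / (1 + real n * bump a b x)" for n
  proof -
    have "1 + real n * bump a b x > 0" using p by (simp add: add_pos_nonneg)
    then show ?thesis by (simp add: field_simps)
  qed
  ultimately show ?thesis using True by simp
next
  case False
  then have "bump a b x = 0" using bump_pos_iff[of a b x] bump_nonneg[of a b x] by linarith
  then show ?thesis using False by simp
qed

text \<open>Dominated convergence along the plateau functions, whose values lie in [0,1], so that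
  \<open>\<bar>u\<bar>\<close> is a majorant.\<close>

lemma integral_interval_eq_0:
  assumes u: "integrable leb01 u"
    and test: "\<And>\<phi>. test_fun \<phi> \<Longrightarrow> (\<integral>x. u x * \<phi> x \<partial>leb01) = 0"
    and ab: "0 < a" "b < 1"
  shows "(\<integral>x. u x * indicator {a<..<b} x \<partial>leb01) = 0"
proof -
  define \<phi> where "\<phi> n x = real n * bump a b x / (1 + real n * bump a b x)" for n x
  have t: "test_fun (\<phi> n)" for n unfolding \<phi>_def by (rule test_fun_plateau[OF ab]) simp
  have \<phi>: "0 \<le> \<phi> n x" "\<phi> n x \<le> 1" for n x
    using bump_nonneg[of a b x] by (auto simp: \<phi>_def divide_le_eq_1 add_nonneg_pos add_pos_nonneg)
  have [measurable]: "u \<in> borel_measurable leb01" using u by auto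
  have m[measurable]: "\<phi> n \<in> borel_measurable leb01" for n
    by (intro leb01_continuous(1) continuous_on_subset[OF test_funD(3)[OF t]]) auto
  have "(\<lambda>n. \<integral>x. u x * \<phi> n x \<partial>leb01) \<longlonglongrightarrow> (\<integral>x. u x * indicator {a<..<b} x \<partial>leb01)"
  proof (rule integral_dominated_convergence)
    show "integrable leb01 (\<lambda>x. \<bar>u x\<bar>)" using u by simp
    have "(\<lambda>n. u x * \<phi> n x) \<longlonglongrightarrow> u x * indicator {a<..<b} x" for x
      unfolding \<phi>_def by (intro tendsto_intros plateau_tendsto)
    then show "AE x in leb01. (\<lambda>n. u x * \<phi> n x) \<longlonglongrightarrow> u x * indicator {a<..<b} x" by simp
    show "AE x in leb01. norm (u x * \<phi> n x) \<le> \<bar>u x\<bar>" for n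
      using \<phi> by (auto simp: abs_mult intro!: AE_I2 mult_left_le)
    have "(indicator {a<..<b} :: real \<Rightarrow> real) \<in> borel_measurable leb01"
      by (rule borel_measurable_leb01) simp
    then show "(\<lambda>x. u x * indicator {a<..<b} x) \<in> borel_measurable leb01" by measurable
  qed measurable
  then show ?thesis using test[OF t] by (simp add: LIMSEQ_const_iff)
qed

text \<open>Since \<open>ennreal\<close> sends negative numbers to 0, \<open>P\<close> and
  \<open>Q\<close> have the positive and the negative part of \<open>g\<close> as densities. They
  agree on all half-lines, hence are equal, and densities are unique almost everywhere.\<close>

lemma AE_lborel_eq_0I:
  fixes g :: "real \<Rightarrow> real"
  assumes g: "integrable lborel g"
    and zero: "\<And>x. (\<integral>t. g t * indicator {x<..} t \<partial>lborel) = 0"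
  shows "AE x in lborel. g x = 0"
proof -
  have [measurable]: "g \<in> borel_measurable lborel" using g by auto
  have gi: "integrable lborel (\<lambda>t. g t * indicator {x<..} t)" for x
    using g by (intro integrable_real_mult_indicator) auto
  define P where "P = density lborel (\<lambda>t. ennreal (g t))"
  define Q where "Q = density lborel (\<lambda>t. ennreal (- g t))"
  have P: "emeasure P {x<..} = (\<integral>\<^sup>+t. ennreal (g t * indicator {x<..} t) \<partial>lborel)" for x
    unfolding P_def by (subst emeasure_density) (auto intro!: nn_integral_cong simp: indicator_def)
  have Q: "emeasure Q {x<..} = (\<integral>\<^sup>+t. ennreal (- (g t * indicator {x<..} t)) \<partial>lborel)" for x
    unfolding Q_def by (subst emeasure_density) (auto intro!: nn_integral_cong simp: indicator_def)
  \<comment> \<open>Finiteness turns a vanishing difference of the two integrals into equality in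
    \<open>ennreal\<close>, and half-lines of finite measure are what identifies the
    measures.\<close>
  have fin: "emeasure P {x<..} < \<infinity>" "emeasure Q {x<..} < \<infinity>" for x
    using gi[of x] unfolding P Q real_integrable_def by (auto simp: top.not_eq_extremum)
  have "emeasure P {x<..} = emeasure Q {x<..}" for x
  proof -
    have "enn2real (emeasure P {x<..}) = enn2real (emeasure Q {x<..})"
      using real_lebesgue_integral_def[OF gi, of x] zero[of x] by (simp add: P Q)
    then show ?thesis using fin[of x] by (metis ennreal_enn2real infinity_ennreal_def)
  qed
  then have "P = Q"
    using fin by (intro measure_eqI_lessThan) (auto simp: P_def Q_def)
  then have "AE t in lborel. ennreal (g t) = ennreal (- g t)"
    unfolding P_def Q_def by (subst (asm) sigma_finite_measure.density_unique_iff[OF sigma_finite_lborel]) auto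
  \<comment> \<open>The positive and the negative part are never both nonzero, so if they are equal,
    both vanish.\<close>
  then show ?thesis
  proof (rule AE_mp, intro AE_I2 impI)
    fix t assume eq: "ennreal (g t) = ennreal (- g t)"
    show "g t = 0"
    proof (rule ccontr)
      assume "g t \<noteq> 0"
      then consider "g t > 0" | "g t < 0" by linarith
      then show False
      proof cases
        case 1
        then have "ennreal (- g t) = 0" "ennreal (g t) \<noteq> 0" by (simp_all add: ennreal_neg ennreal_eq_0_iff)
        then show False using eq by simp
      next
        case 2
        then have "ennreal (g t) = 0" "ennreal (- g t) \<noteq> 0" by (simp_all add: ennreal_neg ennreal_eq_0_iff)
        then show False using eq by simp
      qed
    qed
  qed
qed

text \<open>Vanishing against test functions passes to intervals compactly inside (0,1), by
  exhaustion to half-lines, and from there to the function itself after extension by zero to the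
  line.\<close>

lemma fundamental_lemma:
  assumes u: "integrable leb01 u"
    and test: "\<And>\<phi>. test_fun \<phi> \<Longrightarrow> (\<integral>x. u x * \<phi> x \<partial>leb01) = 0"
  shows "AE x in leb01. u x = 0"
proof -
  have ms: "u \<in> borel_measurable leb01" using u by auto
  define U where "U x = indicator {0<..<1} x * u x" for x
  have U: "integrable lebesgue U"
    using u unfolding U_def by (subst (asm) integrable_restrict_space) auto
  have U_int: "(\<integral>x. u x * f x \<partial>leb01) = (\<integral>x. U x * f x \<partial>lebesgue)" for f :: "real \<Rightarrow> real"
    by (subst integral_restrict_space) (auto simp: U_def mult_ac)
  have Um: "U \<in> borel_measurable (completion lborel)" using U by auto
  \<comment> \<open>A Borel version of \<open>U\<close> is needed to leave the completed measure for
    \<open>lborel\<close>, where half-lines determine a measure.\<close>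
  obtain g where g: "g \<in> borel_measurable lborel" "AE x in lborel. U x = g x"
    using completion_ex_borel_measurable_real[OF Um] by blast
  then have ae: "AE x in lebesgue. U x = g x" by (intro AE_completion)
  have gm: "g \<in> borel_measurable lebesgue" using g(1) by (rule measurable_completion)
  have "integrable lebesgue g"
    using U integrable_cong_AE[OF _ gm ae] Um by simp
  then have gi: "integrable lborel g" using integrable_completion[OF g(1)] by simp
  have "(\<integral>t. g t * indicator {x<..} t \<partial>lborel) = 0" for x
  proof -
    \<comment> \<open>The intervals from \<open>A n\<close> to \<open>B n\<close> stay away from 0
      and 1, as test functions demand, and exhaust the part of (0,1) to the right of
      \<open>x\<close>; for small \<open>n\<close> they may be empty.\<close>
    define A where "A n = max x 0 + inverse (real (Suc n))" for n
    define B where "B n = 1 - inverse (real (Suc n))" for n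
    have A: "x < A n" "0 < A n" and B: "B n < 1" for n
    proof -
      have "inverse (real (Suc n)) > 0" by simp
      then show "x < A n" "0 < A n" "B n < 1" unfolding A_def B_def by linarith+
    qed
    have lim: "(\<lambda>n. indicator {A n<..<B n} t :: real) \<longlonglongrightarrow> indicator {x<..} t" if t: "t \<in> {0<..<1}" for t
    proof (cases "x < t")
      case True
      have "A \<longlonglongrightarrow> max x 0 + 0" "B \<longlonglongrightarrow> 1 - 0"
        unfolding A_def B_def by (intro tendsto_intros LIMSEQ_inverse_real_of_nat)+
      then have "eventually (\<lambda>n. A n < t) sequentially" "eventually (\<lambda>n. t < B n) sequentially"
        using True t by (auto intro!: order_tendstoD)
      then have "eventually (\<lambda>n. indicator {A n<..<B n} t = (indicator {x<..} t :: real)) sequentially"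
        by eventually_elim (use True in auto)
      then show ?thesis by (rule tendsto_eventually)
    next
      case False
      have "indicator {A n<..<B n} t = (indicator {x<..} t :: real)" for n
        using False A(1)[of n] by (auto simp: indicator_def)
      then show ?thesis by simp
    qed
    have [measurable]: "(\<lambda>t. indicator {a<..<b} t :: real) \<in> borel_measurable leb01"
        "(\<lambda>t. indicator {a<..} t :: real) \<in> borel_measurable leb01" for a b
      by (rule borel_measurable_leb01, simp)+
    have [measurable]: "u \<in> borel_measurable leb01" by (rule ms)
    have "(\<lambda>n. \<integral>t. u t * indicator {A n<..<B n} t \<partial>leb01) \<longlonglongrightarrow> (\<integral>t. u t * indicator {x<..} t \<partial>leb01)"
    proof (rule integral_dominated_convergence)
      show "integrable leb01 (\<lambda>x. \<bar>u x\<bar>)" using u by simp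
      show "AE t in leb01. (\<lambda>n. u t * indicator {A n<..<B n} t) \<longlonglongrightarrow> u t * indicator {x<..} t"
        by (intro AE_I2 tendsto_intros lim) (simp add: space_restrict_space)
      show "AE t in leb01. norm (u t * indicator {A n<..<B n} t) \<le> \<bar>u t\<bar>" for n
        by (auto simp: abs_mult indicator_def)
    qed measurable
    moreover have "(\<integral>t. u t * indicator {A n<..<B n} t \<partial>leb01) = 0" for n
      by (rule integral_interval_eq_0[OF u test A(2) B])
    ultimately have "(\<integral>t. u t * indicator {x<..} t \<partial>leb01) = 0"
      by (simp add: LIMSEQ_const_iff)
    then have "(\<integral>t. U t * indicator {x<..} t \<partial>lebesgue) = 0" by (simp add: U_int)
    also have "(\<integral>t. U t * indicator {x<..} t \<partial>lebesgue) = (\<integral>t. g t * indicator {x<..} t \<partial>lebesgue)"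
    proof (rule integral_cong_AE)
      have [measurable]: "(\<lambda>t. indicator {x<..} t :: real) \<in> borel_measurable lebesgue"
        by (intro borel_measurable_indicator) auto
      show "(\<lambda>t. U t * indicator {x<..} t) \<in> borel_measurable lebesgue" using Um by measurable
      show "(\<lambda>t. g t * indicator {x<..} t) \<in> borel_measurable lebesgue" using gm by measurable
      show "AE t in lebesgue. U t * indicator {x<..} t = g t * indicator {x<..} t"
        using ae by eventually_elim simp
    qed
    also have "\<dots> = (\<integral>t. g t * indicator {x<..} t \<partial>lborel)"
      using g(1) by (intro integral_completion borel_measurable_times borel_measurable_indicator) auto
    finally show ?thesis by simp
  qed
  then have "AE x in lborel. g x = 0" by (rule AE_lborel_eq_0I[OF gi])
  then have "AE x in lebesgue. g x = 0" by (rule AE_completion)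
  with ae have "AE x in lebesgue. U x = 0" by eventually_elim simp
  then show ?thesis
    by (subst AE_restrict_space_iff) (auto simp: U_def)
qed

section \<open>Weak versus classical derivatives\<close>

lemma has_weak_deriv_unique:
  assumes g: "integrable leb01 g" "integrable leb01 g'"
    and wd: "has_weak_deriv u g" "has_weak_deriv u g'"
  shows "AE x in leb01. g x = g' x"
proof -
  have "AE x in leb01. g x - g' x = 0"
  proof (rule fundamental_lemma)
    fix \<phi> assume t: "test_fun \<phi>"
    have "continuous_on {0..1} \<phi>" using test_funD(3)[OF t] continuous_on_subset by blast
    note i = integrable_leb01_mult_continuous[OF g(1) this] integrable_leb01_mult_continuous[OF g(2) this]
    have "(\<integral>x. (g x - g' x) * \<phi> x \<partial>leb01) = (\<integral>x. g x * \<phi> x \<partial>leb01) - (\<integral>x. g' x * \<phi> x \<partial>leb01)"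
      using i by (simp add: left_diff_distrib)
    also have "\<dots> = 0" using wd t by (simp add: has_weak_deriv_def)
    finally show "(\<integral>x. (g x - g' x) * \<phi> x \<partial>leb01) = 0" .
  qed (use g in simp)
  then show ?thesis by eventually_elim simp
qed

lemma has_weak_deriv_cong_AE:
  assumes m: "u \<in> borel_measurable leb01" "u' \<in> borel_measurable leb01"
      "g \<in> borel_measurable leb01" "g' \<in> borel_measurable leb01"
    and ae: "AE x in leb01. u x = u' x" "AE x in leb01. g x = g' x"
    and wd: "has_weak_deriv u g"
  shows "has_weak_deriv u' g'"
  unfolding has_weak_deriv_def
proof (intro allI impI)
  fix \<phi> assume t: "test_fun \<phi>"
  have c: "continuous_on {0..1} \<phi>" "continuous_on {0..1} (deriv \<phi>)"
    using test_funD(2,3)[OF t] continuous_on_subset by blast+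
  note m' = m leb01_continuous(1)[OF c(1)] leb01_continuous(1)[OF c(2)]
  have "(\<integral>x. u' x * deriv \<phi> x \<partial>leb01) = (\<integral>x. u x * deriv \<phi> x \<partial>leb01)"
    using ae(1) m' by (intro integral_cong_AE borel_measurable_times) (auto elim: eventually_mono)
  also have "\<dots> = - (\<integral>x. g x * \<phi> x \<partial>leb01)"
    using wd t by (simp add: has_weak_deriv_def)
  also have "(\<integral>x. g x * \<phi> x \<partial>leb01) = (\<integral>x. g' x * \<phi> x \<partial>leb01)"
    using ae(2) m' by (intro integral_cong_AE borel_measurable_times) (auto elim: eventually_mono)
  finally show "(\<integral>x. u' x * deriv \<phi> x \<partial>leb01) = - (\<integral>x. g' x * \<phi> x \<partial>leb01)" .
qed

text \<open>Integration by parts, with boundary terms killed by the support of the test function.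
  Differentiability inside (0,1) and continuity up to the boundary suffice for this.\<close>

lemma classical_deriv_has_weak_deriv:
  assumes u: "continuous_on {0..1} u" and g: "continuous_on {0..1} g"
    and d: "\<And>x. x \<in> {0<..<1} \<Longrightarrow> (u has_real_derivative g x) (at x)"
  shows "has_weak_deriv u g"
  unfolding has_weak_deriv_def
proof (intro allI impI)
  fix \<phi> assume t: "test_fun \<phi>"
  have c: "continuous_on {0..1} \<phi>" "continuous_on {0..1} (deriv \<phi>)"
    using test_funD(2,3)[OF t] continuous_on_subset by blast+
  obtain a b where "0 < a" "b < 1" "\<And>x. x \<notin> {a..b} \<Longrightarrow> \<phi> x = 0"
    using test_fun_support[OF t] by metis
  then have \<phi>01: "\<phi> 0 = 0" "\<phi> 1 = 0" by auto
  have c1: "continuous_on {0..1} (\<lambda>x. u x * deriv \<phi> x)" "continuous_on {0..1} (\<lambda>x. g x * \<phi> x)"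
    using u g c by (auto intro: continuous_intros)
  have "((\<lambda>x. u x * deriv \<phi> x + g x * \<phi> x) has_integral u 1 * \<phi> 1 - u 0 * \<phi> 0) {0..1}"
  proof (rule fundamental_theorem_of_calculus_interior)
    show "continuous_on {0..1} (\<lambda>x. u x * \<phi> x)" using u c by (auto intro: continuous_intros)
    show "((\<lambda>x. u x * \<phi> x) has_vector_derivative u x * deriv \<phi> x + g x * \<phi> x) (at x)" if "x \<in> {0<..<1}" for x
      using DERIV_mult[OF d[OF that] test_funD(1)[OF t]]
      by (simp add: algebra_simps flip: has_real_derivative_iff_has_vector_derivative)
  qed simp
  then have "integral {0..1} (\<lambda>x. u x * deriv \<phi> x + g x * \<phi> x) = 0"
    using \<phi>01 by (simp add: integral_unique)
  then have "integral {0..1} (\<lambda>x. u x * deriv \<phi> x) + integral {0..1} (\<lambda>x. g x * \<phi> x) = 0"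
    using c1 by (subst (asm) Henstock_Kurzweil_Integration.integral_add)
      (auto intro: integrable_continuous_real)
  then show "(\<integral>x. u x * deriv \<phi> x \<partial>leb01) = - (\<integral>x. g x * \<phi> x \<partial>leb01)"
    using leb01_continuous(3)[OF c1(1)] leb01_continuous(3)[OF c1(2)] by simp
qed

text \<open>The zero mean is what brings the primitive back to 0 to the right of \<open>b\<close>,
  so that its support is again compact in (0,1).\<close>

lemma test_fun_primitive:
  assumes f: "continuous_on UNIV f" and ab: "0 < a" "a < b" "b < 1"
    and f0: "\<And>x. x \<notin> {a..b} \<Longrightarrow> f x = 0" and int0: "integral {0..1} f = 0"
  obtains \<phi> where "test_fun \<phi>" "\<And>x. deriv \<phi> x = f x"
proof -
  \<comment> \<open>Setting the value 0 outside [0,1] glues smoothly, because the primitive already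
    vanishes near both endpoints.\<close>
  define \<phi> where "\<phi> x = (if x \<in> {0..1} then integral {0..x} f else 0)" for x
  have c: "continuous_on S f" for S using f continuous_on_subset by blast
  have low: "integral {0..x} f = 0" if "x < a" for x
    using Henstock_Kurzweil_Integration.integral_cong[of "{0..x}" f "\<lambda>_. 0"] f0 that by simp
  have "integral {0..x} f = 0" if "b < x" "x \<le> 1" for x
  proof -
    have "integral {0..x} f + integral {x..1} f = integral {0..1} f"
      using that ab by (intro Henstock_Kurzweil_Integration.integral_combine integrable_continuous_real c) auto
    moreover have "integral {x..1} f = 0"
      using Henstock_Kurzweil_Integration.integral_cong[of "{x..1}" f "\<lambda>_. 0"] f0 that by simp
    ultimately show ?thesis using int0 by simp
  qed
  with low have \<phi>0: "\<phi> x = 0" if "x \<notin> {a..b}" for x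
    using that by (auto simp: \<phi>_def)
  have d: "(\<phi> has_real_derivative f x) (at x)" for x
  proof (cases "x \<in> {0<..<1}")
    case True
    then have "((\<lambda>u. integral {0..u} f) has_real_derivative f x) (at x)"
      using integral_has_real_derivative[OF c, of x 0 1] by (simp add: at_within_Icc_at)
    then show ?thesis
      by (rule has_field_derivative_transform_within_open[of _ _ _ "{0<..<1}"])
        (use True in \<open>auto simp: \<phi>_def\<close>)
  next
    case False
    have x: "x \<in> - {a..b}" using False ab by auto
    have "((\<lambda>_. 0) has_real_derivative f x) (at x)" using x f0[of x] by simp
    then show ?thesis
      by (rule has_field_derivative_transform_within_open[of _ _ _ "- {a..b}"])
        (use x \<phi>0 in auto)
  qed
  have "test_fun \<phi>" by (rule test_funI[OF d f ab(1,3) \<phi>0])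
  moreover have "deriv \<phi> x = f x" for x using d by (rule DERIV_imp_deriv)
  ultimately show ?thesis using that by blast
qed

text \<open>The hypothesis tests \<open>m\<close> only against derivatives of test functions, that
  is, against those of mean zero. This determines \<open>m\<close> up to a constant, and continuity
  upgrades equality almost everywhere to equality on [0,1].\<close>

lemma du_Bois_Reymond:
  assumes m: "continuous_on {0..1} m"
    and wd: "has_weak_deriv m (\<lambda>_. 0)"
  obtains c where "\<And>x. x \<in> {0..1} \<Longrightarrow> m x = c"
proof -
  \<comment> \<open>Subtracting a multiple of \<open>\<rho>\<close> makes any test function \<open>\<psi>\<close> the derivative of another one.\<close>
  have "\<exists>\<rho>. test_fun \<rho> \<and> (\<integral>x. \<rho> x \<partial>leb01) \<noteq> 0"
  proof (rule ccontr)
    assume "\<nexists>\<rho>. test_fun \<rho> \<and> (\<integral>x. \<rho> x \<partial>leb01) \<noteq> 0"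
    \<comment> \<open>If every test function had mean zero, the fundamental lemma would apply to the
      constant 1.\<close>
    then have "AE x in leb01. (1::real) = 0"
      by (intro fundamental_lemma leb01_continuous) auto
    then show False
      using AE_leb01_continuous_eq[of "\<lambda>_. 1" "\<lambda>_. 0" 0] by simp
  qed
  then obtain \<rho> where \<rho>: "test_fun \<rho>" "(\<integral>x. \<rho> x \<partial>leb01) \<noteq> 0" by blast
  have c01: "continuous_on {0..1} \<psi>" if "test_fun \<psi>" for \<psi>
    using test_funD(3)[OF that] continuous_on_subset by blast
  obtain a b where \<rho>ab: "0 < a" "a < b" "b < 1" "\<And>x. x \<notin> {a..b} \<Longrightarrow> \<rho> x = 0"
    using test_fun_support[OF \<rho>(1)] by metis
  \<comment> \<open>The only possible value: \<open>m - c\<close> must be orthogonal to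
    \<open>\<rho>\<close>.\<close>
  define c where "c = (\<integral>x. m x * \<rho> x \<partial>leb01) / (\<integral>x. \<rho> x \<partial>leb01)"
  have "AE x in leb01. m x - c = 0"
  proof (rule fundamental_lemma)
    show "integrable leb01 (\<lambda>x. m x - c)"
      using m by (intro leb01_continuous continuous_intros)
    fix \<psi> assume \<psi>: "test_fun \<psi>"
    obtain a' b' where \<psi>ab: "0 < a'" "a' < b'" "b' < 1" "\<And>x. x \<notin> {a'..b'} \<Longrightarrow> \<psi> x = 0"
      using test_fun_support[OF \<psi>] by metis
    \<comment> \<open>The multiple for which \<open>\<psi> - s * \<rho>\<close> has mean
      zero.\<close>
    define s where "s = (\<integral>x. \<psi> x \<partial>leb01) / (\<integral>x. \<rho> x \<partial>leb01)"
    define f where "f x = \<psi> x - s * \<rho> x" for x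
    note i = leb01_continuous(2)[OF c01[OF \<psi>]] leb01_continuous(2)[OF c01[OF \<rho>(1)]]
    note im = leb01_continuous(2)[OF continuous_on_mult[OF m c01[OF \<psi>]]]
      leb01_continuous(2)[OF continuous_on_mult[OF m c01[OF \<rho>(1)]]]
    have fc: "continuous_on UNIV f"
      unfolding f_def by (intro continuous_intros test_funD \<psi> \<rho>)
    have "(\<integral>x. f x \<partial>leb01) = 0"
      using i \<rho>(2) by (simp add: f_def s_def)
    then have f_int: "integral {0..1} f = 0"
      using leb01_continuous(3)[of f] fc continuous_on_subset by (metis UNIV_I subsetI)
    obtain \<phi> where \<phi>: "test_fun \<phi>" "\<And>x. deriv \<phi> x = f x"
    proof (rule test_fun_primitive[OF fc _ _ _ _ f_int, of "min a a'" "max b b'"])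
      show "f x = 0" if "x \<notin> {min a a'..max b b'}" for x
      proof -
        have "x \<notin> {a..b}" "x \<notin> {a'..b'}" using that by auto
        then show ?thesis by (simp add: f_def \<rho>ab(4) \<psi>ab(4))
      qed
    qed (use \<rho>ab \<psi>ab in auto)
    have "(\<integral>x. m x * f x \<partial>leb01) = 0"
      using wd \<phi>(1) by (simp add: has_weak_deriv_def flip: \<phi>(2))
    then have "(\<integral>x. m x * \<psi> x \<partial>leb01) = s * (\<integral>x. m x * \<rho> x \<partial>leb01)"
      using im by (simp add: f_def right_diff_distrib mult.left_commute)
    also have "\<dots> = c * (\<integral>x. \<psi> x \<partial>leb01)" by (simp add: s_def c_def)
    finally show "(\<integral>x. (m x - c) * \<psi> x \<partial>leb01) = 0"
      using i im by (simp add: left_diff_distrib)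
  qed
  then have ae: "AE x in leb01. m x = c" by eventually_elim simp
  show ?thesis
    by (rule that[of c]) (use AE_leb01_continuous_eq[OF m continuous_on_const ae] in auto)
qed

text \<open>The primitive \<open>G\<close> of \<open>g\<close> has the same weak derivative as
  \<open>u\<close>, so \<open>u - G\<close> has weak derivative zero and is constant.\<close>

lemma has_weak_deriv_continuous:
  assumes u: "continuous_on {0..1} u" and g: "continuous_on {0..1} g" and wd: "has_weak_deriv u g"
    and x: "x \<in> {0..1}"
  shows "(u has_real_derivative g x) (at x within {0..1})"
proof -
  define G where "G x = integral {0..x} g" for x
  have G: "(G has_real_derivative g x) (at x within {0..1})" if "x \<in> {0..1}" for x
    unfolding G_def using g that by (rule integral_has_real_derivative)
  have Gc: "continuous_on {0..1} G"
    unfolding G_def by (intro indefinite_integral_continuous_1 integrable_continuous_real g)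
  have "(G has_real_derivative g x) (at x)" if "x \<in> {0<..<1}" for x
    using G[of x] that by (simp add: at_within_Icc_at)
  then have wdG: "has_weak_deriv G g" by (rule classical_deriv_has_weak_deriv[OF Gc g])
  have "has_weak_deriv (\<lambda>x. u x - G x) (\<lambda>_. 0)"
    unfolding has_weak_deriv_def
  proof (intro allI impI)
    fix \<phi> assume t: "test_fun \<phi>"
    have c: "continuous_on {0..1} (deriv \<phi>)"
      using test_funD(2)[OF t] continuous_on_subset by blast
    have "(\<integral>x. (u x - G x) * deriv \<phi> x \<partial>leb01)
        = (\<integral>x. u x * deriv \<phi> x \<partial>leb01) - (\<integral>x. G x * deriv \<phi> x \<partial>leb01)"
      using leb01_continuous(2)[OF continuous_on_mult[OF u c]]
        leb01_continuous(2)[OF continuous_on_mult[OF Gc c]] by (simp add: left_diff_distrib)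
    also have "\<dots> = 0" using wd wdG t by (simp add: has_weak_deriv_def)
    finally show "(\<integral>x. (u x - G x) * deriv \<phi> x \<partial>leb01) = - (\<integral>x. 0 * \<phi> x \<partial>leb01)" by simp
  qed
  then obtain c where c: "\<And>x. x \<in> {0..1} \<Longrightarrow> u x - G x = c"
    using du_Bois_Reymond[OF continuous_on_diff[OF u Gc]] by blast
  have "((\<lambda>x. G x + c) has_real_derivative g x) (at x within {0..1})"
    using DERIV_add[OF G[OF x] DERIV_const[of c]] by simp
  then show ?thesis
    using c x by (auto intro: has_field_derivative_transform_within[where d = 1] simp: algebra_simps)
qed

text \<open>\<open>f\<close> is only required to equal \<open>u\<close> almost everywhere, so that
  the lemma applies a second time with \<open>weak_deriv f\<close> in the role of
  \<open>f\<close>.\<close>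

lemma weak_deriv_classical:
  assumes f: "f \<in> borel_measurable leb01" "AE x in leb01. f x = u x"
    and u: "continuous_on {0..1} u" and g: "continuous_on {0..1} g"
    and d: "\<And>x. x \<in> {0<..<1} \<Longrightarrow> (u has_real_derivative g x) (at x)"
  shows "f \<in> H1_01" "weak_deriv f \<in> borel_measurable leb01" "AE x in leb01. weak_deriv f x = g x"
proof -
  note m = L2_01_measurable[OF continuous_imp_L2_01[OF u]] L2_01_measurable[OF continuous_imp_L2_01[OF g]]
  have fL: "f \<in> L2_01" by (rule L2_01_cong_AE[OF continuous_imp_L2_01[OF u] f])
  have ae: "AE x in leb01. u x = f x" using f(2) by eventually_elim simp
  have wd: "has_weak_deriv f g"
    by (rule has_weak_deriv_cong_AE[OF m(1) f(1) m(2) m(2) ae _ classical_deriv_has_weak_deriv[OF u g d]]) auto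
  then show "f \<in> H1_01" using fL continuous_imp_L2_01[OF g] by (auto simp: H1_01_def)
  have *: "weak_deriv f \<in> L2_01 \<and> has_weak_deriv f (weak_deriv f)"
    unfolding weak_deriv_def using wd continuous_imp_L2_01[OF g]
    by (intro someI[where P = "\<lambda>g. g \<in> L2_01 \<and> has_weak_deriv f g"]) auto
  then show "weak_deriv f \<in> borel_measurable leb01" by (simp add: L2_01_measurable)
  show "AE x in leb01. weak_deriv f x = g x"
    using * wd continuous_imp_L2_01[OF g] by (intro has_weak_deriv_unique[of _ _ f] L2_01_integrable) auto
qed

lemma H1_01_weak_deriv:
  assumes "u \<in> H1_01"
  shows "weak_deriv u \<in> L2_01" "has_weak_deriv u (weak_deriv u)"
proof -
  have "\<exists>g. g \<in> L2_01 \<and> has_weak_deriv u g" using assms by (auto simp: H1_01_def)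
  then have "weak_deriv u \<in> L2_01 \<and> has_weak_deriv u (weak_deriv u)"
    unfolding weak_deriv_def by (rule someI_ex)
  then show "weak_deriv u \<in> L2_01" "has_weak_deriv u (weak_deriv u)" by auto
qed


section \<open>The kernel of the linearised operator\<close>

lemma real_analytic_on_imp_continuous_on:
  assumes "g real_analytic_on S"
  shows "continuous_on S g"
proof (rule continuous_at_imp_continuous_on, rule ballI)
  fix x assume "x \<in> S"
  then obtain F where "(\<lambda>h. g (x + h)) has_fps_expansion F"
    using assms by (auto simp: real_analytic_on_def)
  then have "isCont (\<lambda>h. g (x + h)) 0" by (rule has_fps_expansion_imp_continuous)
  then have c: "isCont (\<lambda>h. g (x + h)) (x - x)" by simp
  have "isCont (\<lambda>y. y - x) x" by (intro continuous_intros)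
  from isCont_o2[OF this c] show "isCont g x" by simp
qed

section \<open>The linearised equation and its relation to the kernel\<close>

lemma linearised_unique:
  assumes v: "continuous_on {0..1} v"
    and u: "ode2_solution (linearised_rhs L v) u w" "ode2_solution (linearised_rhs L v) u' w'"
    and init: "u 0 = u' 0" "w 0 = w' 0" and t: "t \<in> {0..1}"
  shows "u t = u' t" "w t = w' t"
proof -
  obtain M where M: "\<And>t. t \<in> {0..1} \<Longrightarrow> \<bar>v t\<bar> \<le> M"
    using continuous_on_01_bounded[OF v] by blast
  obtain N where N: "\<And>t. t \<in> {0..1} \<Longrightarrow> \<bar>u t\<bar> \<le> N"
    using continuous_on_01_bounded[OF ode2_solutionD(4)[OF u(1)]] by blast
  obtain N' where N': "\<And>t. t \<in> {0..1} \<Longrightarrow> \<bar>u' t\<bar> \<le> N'"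
    using continuous_on_01_bounded[OF ode2_solutionD(4)[OF u(2)]] by blast
  have lip: "\<bar>linearised_rhs L v t x - linearised_rhs L v t y\<bar> \<le> L\<^sup>2 * (3 * M\<^sup>2 + 1) * \<bar>x - y\<bar>"
    if "t \<in> {0<..<1}" for t x y
    using that by (intro linearised_rhs_lipschitz M) simp
  have K: "L\<^sup>2 * (3 * M\<^sup>2 + 1) \<ge> 0" by simp
  note uniq = ode2_unique[OF u lip K max.coboundedI1[OF N] max.coboundedI2[OF N'] init t]
  show "u t = u' t" by (rule uniq(1))
  show "w t = w' t" by (rule uniq(2))
qed

lemma linearised_scale:
  assumes "ode2_solution (linearised_rhs L v) u w"
  shows "ode2_solution (linearised_rhs L v) (\<lambda>t. c * u t) (\<lambda>t. c * w t)"
proof -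
  note D = ode2_solutionD[OF assms]
  have "((\<lambda>t. c * w t) has_real_derivative linearised_rhs L v t (c * u t)) (at t)" if "t \<in> {0<..<1}" for t
    using DERIV_cmult[OF D(3)[OF that], of c] by (simp add: linearised_rhs_def mult_ac)
  then show ?thesis
    using D(1,5) by (auto simp: ode2_solution_def intro: DERIV_cmult continuous_intros)
qed

lemma ode2_solution_zero: "ode2_solution (linearised_rhs L v) (\<lambda>_. 0) (\<lambda>_. 0)"
  by (simp add: ode2_solution_def linearised_rhs_def)

text \<open>A classical solution is its own C^1 representative, and the right-hand side is
  continuous up to the boundary; so both weak derivatives agree almost everywhere with the classical
  ones.\<close>

lemma linearised_solution_in_kernel:
  assumes v: "continuous_on {0..1} v"
    and u: "ode2_solution (linearised_rhs L v) u w" and bc: "u 0 = 0" "w 1 = 0"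
  shows "ae_class u \<in> ker_M L v"
proof -
  note D = ode2_solutionD[OF u]
  have c: "continuous_on {0..1} (\<lambda>t. linearised_rhs L v t (u t))"
    unfolding linearised_rhs_def by (intro continuous_intros v D)
  note m = L2_01_measurable[OF continuous_imp_L2_01[OF D(4)]]
  note wu = weak_deriv_classical[OF m _ D(4,5,2), simplified]
  note wwu = weak_deriv_classical[OF wu(2,3) D(5) c D(3), simplified]
  have "u \<in> H2_01" using wu(1) wwu(1) by (simp add: H2_01_def)
  then have "u \<in> dom_M"
    unfolding dom_M_def using D(1,5) bc by (intro CollectI conjI exI[of _ u] exI[of _ w]) auto
  moreover have "AE y in leb01. op_M L v u y = 0"
    using wwu(3) by eventually_elim (simp add: op_M_def linearised_rhs_def)
  ultimately show ?thesis by (auto simp: ker_M_def)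
qed

text \<open>Regularity comes from the equation: it identifies the second weak derivative with the
  continuous function \<open>q\<close>, so the slope \<open>w\<close> of the C^1 representative has
  a continuous weak derivative and is classically differentiable.\<close>

lemma kernel_representative:
  assumes v: "continuous_on {0..1} v" and A: "A \<in> ker_M L v"
  obtains f u w where "A = ae_class f" "AE x in leb01. f x = u x"
    "ode2_solution (linearised_rhs L v) u w" "u 0 = 0" "w 1 = 0"
proof -
  obtain f where f: "A = ae_class f" "f \<in> dom_M" "AE y in leb01. op_M L v f y = 0"
    using A by (auto simp: ker_M_def)
  obtain u w where u: "AE x in leb01. f x = u x"
      "\<And>y. y \<in> {0..1} \<Longrightarrow> (u has_real_derivative w y) (at y within {0..1})"
      "continuous_on {0..1} w" "u 0 = 0" "w 1 = 0"
    using f(2) unfolding dom_M_def by blast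
  have f_H: "f \<in> H1_01" "weak_deriv f \<in> H1_01" using f(2) by (auto simp: dom_M_def H2_01_def)
  have uc: "continuous_on {0..1} u"
    using u(2) by (meson continuous_on_eq_continuous_within has_field_derivative_imp_has_derivative has_derivative_continuous)
  have ud: "(u has_real_derivative w x) (at x)" if "x \<in> {0<..<1}" for x
    using u(2)[of x] that by (simp add: at_within_Icc_at)
  have fm: "f \<in> borel_measurable leb01" using f_H(1) by (auto simp: H1_01_def L2_01_measurable)
  note wf = weak_deriv_classical(3)[OF fm u(1) uc u(3) ud]
  define q where "q t = linearised_rhs L v t (u t)" for t
  have qc: "continuous_on {0..1} q"
    unfolding q_def linearised_rhs_def by (intro continuous_intros v uc)
  have ae: "AE x in leb01. weak_deriv (weak_deriv f) x = q x"
    using f(3) u(1) by eventually_elim (simp add: op_M_def q_def linearised_rhs_def)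
  \<comment> \<open>Replacing \<open>weak_deriv f\<close> by \<open>w\<close> and its weak
    derivative by \<open>q\<close> changes both only on null sets.\<close>
  have "has_weak_deriv w q"
    by (rule has_weak_deriv_cong_AE[OF _ _ _ _ wf ae H1_01_weak_deriv(2)[OF f_H(2)]])
      (use L2_01_measurable H1_01_weak_deriv[OF f_H(1)] H1_01_weak_deriv[OF f_H(2)]
        continuous_imp_L2_01[OF qc] continuous_imp_L2_01[OF u(3)] in auto)
  then have wd: "(w has_real_derivative q x) (at x within {0..1})" if "x \<in> {0..1}" for x
    using has_weak_deriv_continuous[OF u(3) qc] that by blast
  have "(w has_real_derivative q x) (at x)" if "x \<in> {0<..<1}" for x
    using wd[of x] that by (simp add: at_within_Icc_at)
  then have "ode2_solution (linearised_rhs L v) u w"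
    using u(2,3) by (auto simp: ode2_solution_def q_def)
  with f(1) u(1,4,5) show ?thesis using that by blast
qed

lemma ae_class_eq_zeroD:
  assumes "f \<in> borel_measurable leb01" "ae_class f = ae_class (\<lambda>_. 0)"
  shows "AE x in leb01. f x = 0"
proof -
  have "f \<in> ae_class f" using assms(1) by (simp add: ae_class_def)
  then have "f \<in> ae_class (\<lambda>_. 0)" using assms(2) by simp
  then show ?thesis by (simp add: ae_class_def)
qed

lemma ae_class_cong:
  assumes "AE x in leb01. f x = g x"
  shows "ae_class f = ae_class g"
proof -
  have "(AE x in leb01. h x = f x) \<longleftrightarrow> (AE x in leb01. h x = g x)" for h
  proof
    assume "AE x in leb01. h x = f x"
    with assms show "AE x in leb01. h x = g x" by eventually_elim simp
  next
    assume "AE x in leb01. h x = g x"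
    with assms show "AE x in leb01. h x = f x" by eventually_elim simp
  qed
  then show ?thesis by (simp add: ae_class_def)
qed

text \<open>By uniqueness a classical kernel function with initial slope \<open>w 0\<close> is
  \<open>w 0 * h\<close>, so its condition at 1 reads \<open>w 0 * k 1 = 0\<close>.\<close>

lemma ker_M_nontrivial_iff:
  assumes v: "continuous_on {0..1} v"
    and h: "ode2_solution (linearised_rhs L v) h k" "h 0 = 0" "k 0 = 1"
  shows "k 1 = 0 \<longleftrightarrow> ker_M L v \<noteq> {ae_class (\<lambda>_. 0)}"
proof
  assume "k 1 = 0"
  then have mem: "ae_class h \<in> ker_M L v" by (rule linearised_solution_in_kernel[OF v h(1,2)])
  \<comment> \<open>Were \<open>h\<close> null almost everywhere, continuity would make it zero on
    [0,1], contradicting its slope 1 at 0.\<close>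
  have "ae_class h \<noteq> ae_class (\<lambda>_. 0)"
  proof
    assume eq: "ae_class h = ae_class (\<lambda>_. 0)"
    note hc = ode2_solutionD(4)[OF h(1)]
    have "AE x in leb01. h x = 0" by (rule ae_class_eq_zeroD[OF leb01_continuous(1)[OF hc] eq])
    then have "h t = 0" if "t \<in> {0..1}" for t
      by (rule AE_leb01_continuous_eq[OF hc continuous_on_const _ that])
    then have "((\<lambda>_. 0) has_real_derivative k 0) (at 0 within {0..1})"
      by (intro has_field_derivative_transform_within[OF ode2_solutionD(1)[OF h(1)] zero_less_one]) auto
    then have "((\<lambda>_. 0) has_vector_derivative k 0) (at 0 within {0..1})"
      by (simp add: has_real_derivative_iff_has_vector_derivative)
    then have "vector_derivative (\<lambda>_. 0) (at 0 within {0..1::real}) = k 0"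
      by (intro vector_derivative_within_closed_interval) auto
    moreover have "vector_derivative (\<lambda>_. 0::real) (at 0 within {0..1::real}) = 0"
      by (intro vector_derivative_within_closed_interval has_vector_derivative_const) auto
    ultimately show False using h(3) by simp
  qed
  with mem show "ker_M L v \<noteq> {ae_class (\<lambda>_. 0)}" by (metis singletonD)
next
  assume ne: "ker_M L v \<noteq> {ae_class (\<lambda>_. 0)}"
  \<comment> \<open>The zero class is a member, so a kernel different from its singleton contains a
    further element.\<close>
  have "ae_class (\<lambda>_. 0) \<in> ker_M L v"
    by (rule linearised_solution_in_kernel[OF v ode2_solution_zero]) auto
  with ne obtain A where A: "A \<in> ker_M L v" "A \<noteq> ae_class (\<lambda>_. 0)" by blast
  obtain f u w where f: "A = ae_class f" "AE x in leb01. f x = u x"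
    and u: "ode2_solution (linearised_rhs L v) u w" "u 0 = 0" "w 1 = 0"
    by (rule kernel_representative[OF v A(1)])
  have init: "u 0 = w 0 * h 0" "w 0 = w 0 * k 0" using u(2) h(2,3) by simp_all
  note eq = linearised_unique[OF v u(1) linearised_scale[OF h(1)] init]
  have "w 0 \<noteq> 0"
  proof
    assume "w 0 = 0"
    then have "u x = 0" if "x \<in> {0<..<1}" for x
      using that by (subst eq(1)) auto
    then have "AE x in leb01. u x = 0" by (intro AE_I2) (simp add: space_restrict_space)
    with f(2) have "AE x in leb01. f x = 0" by eventually_elim simp
    then have "ae_class f = ae_class (\<lambda>_. 0)" by (rule ae_class_cong)
    with A(2) f(1) show False by simp
  qed
  moreover have "w 1 = w 0 * k 1" by (rule eq(2)) simp
  ultimately show "k 1 = 0" using u(3) by simp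
qed

text \<open>Differentiability is asserted alongside the equivalence because \<open>deriv\<close> is
  total: only together do they make a statement about the actual derivative.\<close>

theorem proposition2p9:
  fixes c\<^sub>0 L\<^sub>0 z\<^sub>0 :: real and \<zeta> :: "real \<Rightarrow> real" and I :: "real set"
  assumes "open I" and "is_interval I" and "{0..} \<subseteq> I"
    and "\<zeta> real_analytic_on I"
    and "\<And>x. x \<in> I \<Longrightarrow> \<zeta> x \<in> {-1<..<0}"
    and "L\<^sub>0 > 0"
    and "ivp_solvable c\<^sub>0 \<zeta> L\<^sub>0 z\<^sub>0"
    and "shoot c\<^sub>0 \<zeta> L\<^sub>0 z\<^sub>0 = 0"
  shows "(\<lambda>z. shoot c\<^sub>0 \<zeta> L\<^sub>0 z) differentiable (at z\<^sub>0) \<and>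
         (deriv (\<lambda>z. shoot c\<^sub>0 \<zeta> L\<^sub>0 z) z\<^sub>0 = 0 \<longleftrightarrow>
          ker_M L\<^sub>0 (ivp_sol c\<^sub>0 \<zeta> L\<^sub>0 z\<^sub>0) \<noteq> {ae_class (\<lambda>_. 0)})"
proof -
  define v where "v = ivp_sol c\<^sub>0 \<zeta> L\<^sub>0 z\<^sub>0"
  have \<zeta>: "continuous_on {0..} \<zeta>"
    using real_analytic_on_imp_continuous_on[OF assms(4)] assms(3) continuous_on_subset by blast
  have "ivp_solution c\<^sub>0 \<zeta> L\<^sub>0 z\<^sub>0 v"
    unfolding v_def ivp_sol_def using assms(7) unfolding ivp_solvable_def by (rule someI_ex)
  then obtain w where v: "ode2_solution (cubic_rhs \<zeta> L\<^sub>0) v w" "v 0 = c\<^sub>0" "w 0 = z\<^sub>0"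
    unfolding ivp_solution_iff by blast
  note vc = ode2_solutionD(4)[OF v(1)]
  obtain M where M: "\<And>t. t \<in> {0..1} \<Longrightarrow> \<bar>v t\<bar> \<le> M"
    using continuous_on_01_bounded[OF vc] by blast
  \<comment> \<open>A linear equation with bounded continuous coefficient is globally Lipschitz, so
    \<open>h\<close> exists on all of [0,1] without a cutoff.\<close>
  have "continuous_on ({0..1} \<times> UNIV) (\<lambda>p. linearised_rhs L\<^sub>0 v (fst p) (snd p))"
    unfolding linearised_rhs_def
    by (intro continuous_intros continuous_on_compose2[OF vc]) auto
  moreover have "\<bar>linearised_rhs L\<^sub>0 v t x - linearised_rhs L\<^sub>0 v t y\<bar> \<le> L\<^sub>0\<^sup>2 * (3 * M\<^sup>2 + 1) * \<bar>x - y\<bar>"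
    if "t \<in> {0..1}" for t x y
    using M[OF that] by (rule linearised_rhs_lipschitz)
  ultimately obtain h k where h: "ode2_solution (linearised_rhs L\<^sub>0 v) h k" "h 0 = 0" "k 0 = 1"
    by (rule ode2_exists)
  have "(shoot c\<^sub>0 \<zeta> L\<^sub>0 has_real_derivative k 1) (at z\<^sub>0)"
    using assms(6) by (intro shoot_has_derivative[OF \<zeta> _ v h]) auto
  moreover from this have "shoot c\<^sub>0 \<zeta> L\<^sub>0 differentiable (at z\<^sub>0)"
    by (auto simp: real_differentiable_def)
  ultimately show ?thesis
    using ker_M_nontrivial_iff[OF vc h] by (auto simp: v_def DERIV_imp_deriv)
qed

end
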